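(* Let $(\mathbb Z\wr\mathbb Z)_0$ be the zero section of $\mathbb Z\wr\mathbb Z$, i.e. the subset of $\mathbb Z\wr\mathbb Z$ consisting of all $(f,x)\in\mathbb Z\wr\mathbb Z$ with $x=0$, with the metric $d_{\mathbb Z\wr\mathbb Z}$ inherited from $\mathbb Z\wr\mathbb Z$. Then for all $p\in[1,2]$, $$\alpha_p^*\left((\mathbb Z\wr\mathbb Z)_0,\,d_{\mathbb Z\wr\mathbb Z}\right)=\frac{p+1}{2p}.$$
   Context: The (restricted) wreath product $\mathbb Z\wr\mathbb Z$ is the group of all pairs $(f,x)$ where $x\in\mathbb Z$ and $f:\mathbb Z\to\mathbb Z$ has finite support, with product $(f,x)(g,y)=\left(z\mapsto f(z)+g(z-x),\,x+y\right)$. $d_{\mathbb Z\wr\mathbb Z}$ is the left-invariant word metric associated with the generators $(\mathbf 0,\pm1)$ and $(\pm\mathbf 1_{\{0\}},0)$, where $\mathbf 0$ is the zero function and $\mathbf 1_{\{0\}}$ is the indicator of $\{0\}$. $L_p$ denotes $L_p([0,1])$. For a metric space $(G,\rho)$, $\alpha_p^*(G,\rho)$ is the supremum of those $\alpha\ge0$ for which there exist a $\rho$-Lipschitz map $f:G\to L_p$ and a constant $c>0$ with $\|f(x)-f(y)\|_p\ge c\,\rho(x,y)^\alpha$ for all $x,y\in G$. *)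

theory Defs
  imports "HOL-Analysis.Analysis" "HOL-Algebra.Group"
begin

definition ZwrZ :: "((int \<Rightarrow> int) \<times> int) monoid" where
  "ZwrZ = \<lparr>carrier = {(f, x). finite {z. f z \<noteq> 0}},
           mult = (\<lambda>(f, x) (g, y). (\<lambda>z. f z + g (z - x), x + y)),
           one = (\<lambda>_. 0, 0)\<rparr>"

definition ZwrZ_gens :: "((int \<Rightarrow> int) \<times> int) set" where
  "ZwrZ_gens = {(\<lambda>_. 0, 1), (\<lambda>_. 0, - 1),
                (\<lambda>z. if z = 0 then 1 else 0, 0), (\<lambda>z. if z = 0 then - 1 else 0, 0)}"

text \<open>Word length and word metric are meaningful only if every element of the group is a product
  of elements of \<open>S\<close>, and symmetric only if \<open>S\<close> is closed under inverses. For
  \<open>ZwrZ_gens\<close> the first fact is \<open>ZwrZ_generated\<close> below.\<close>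

definition word_length :: "('a, 'b) monoid_scheme \<Rightarrow> 'a set \<Rightarrow> 'a \<Rightarrow> nat" where
  "word_length G S g =
     (LEAST n. \<exists>ws. length ws = n \<and> set ws \<subseteq> S \<and> foldr (\<otimes>\<^bsub>G\<^esub>) ws \<one>\<^bsub>G\<^esub> = g)"

definition word_metric :: "('a, 'b) monoid_scheme \<Rightarrow> 'a set \<Rightarrow> 'a \<Rightarrow> 'a \<Rightarrow> real" where
  "word_metric G S g h = real (word_length G S (inv\<^bsub>G\<^esub> g \<otimes>\<^bsub>G\<^esub> h))"

definition d_ZwrZ :: "((int \<Rightarrow> int) \<times> int) \<Rightarrow> ((int \<Rightarrow> int) \<times> int) \<Rightarrow> real" where
  "d_ZwrZ = word_metric ZwrZ ZwrZ_gens"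

definition ZwrZ_zero_section :: "((int \<Rightarrow> int) \<times> int) set" where
  "ZwrZ_zero_section = {g \<in> carrier ZwrZ. snd g = 0}"

text \<open>Elements of \<open>L\<^sub>p([0,1])\<close> are represented by functions rather than by classes modulo
  almost everywhere equality, so \<open>Lp_norm p\<close> is a seminorm. Only norms of differences are used
  below, and these do not depend on the representatives.\<close>

definition Lp :: "real \<Rightarrow> (real \<Rightarrow> real) set" where
  "Lp p = {u \<in> borel_measurable (lebesgue_on {0..1}).
             integrable (lebesgue_on {0..1}) (\<lambda>t. \<bar>u t\<bar> powr p)}"

definition Lp_norm :: "real \<Rightarrow> (real \<Rightarrow> real) \<Rightarrow> real" where
  "Lp_norm p u = (LINT t|lebesgue_on {0..1}. \<bar>u t\<bar> powr p) powr (1 / p)"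

text \<open>The supremum is taken in \<open>[0,\<infinity>]\<close>, since for bounded discrete spaces it is infinite.
  Since \<open>0 powr 0 = 0\<close>, the lower bound for \<open>\<alpha> = 0\<close> only concerns distinct points.\<close>

definition alpha_star :: "real \<Rightarrow> 'a set \<Rightarrow> ('a \<Rightarrow> 'a \<Rightarrow> real) \<Rightarrow> ennreal" where
  "alpha_star p X \<rho> = Sup {ennreal \<alpha> | \<alpha>. 0 \<le> \<alpha> \<and>
     (\<exists>F. (\<forall>x\<in>X. F x \<in> Lp p) \<and>
          (\<exists>L\<ge>0. \<forall>x\<in>X. \<forall>y\<in>X. Lp_norm p (\<lambda>t. F x t - F y t) \<le> L * \<rho> x y) \<and>
          (\<exists>c>0. \<forall>x\<in>X. \<forall>y\<in>X. Lp_norm p (\<lambda>t. F x t - F y t) \<ge> c * \<rho> x y powr \<alpha>))}"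

lemma group_ZwrZ: "group ZwrZ"
proof (rule groupI)
  fix a b assume "a \<in> carrier ZwrZ" "b \<in> carrier ZwrZ"
  then obtain f x g y where ab: "a = (f, x)" "b = (g, y)"
    and fin: "finite {z. f z \<noteq> 0}" "finite {z. g z \<noteq> 0}"
    by (auto simp: ZwrZ_def)
  have "{z. f z + g (z - x) \<noteq> 0} \<subseteq> {z. f z \<noteq> 0} \<union> (\<lambda>z. z + x) ` {z. g z \<noteq> 0}"
    by (auto simp: image_iff) (metis diff_add_cancel)
  then have "finite {z. f z + g (z - x) \<noteq> 0}"
    using fin finite_subset by blast
  then show "a \<otimes>\<^bsub>ZwrZ\<^esub> b \<in> carrier ZwrZ"
    by (simp add: ab ZwrZ_def)
next
  fix a assume "a \<in> carrier ZwrZ"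
  then obtain f x where a: "a = (f, x)" and fin: "finite {z. f z \<noteq> 0}"
    by (auto simp: ZwrZ_def)
  have "{z. f (z + x) \<noteq> 0} \<subseteq> (\<lambda>z. z - x) ` {z. f z \<noteq> 0}"
    by (auto simp: image_iff) (metis add_diff_cancel_right')
  then have "finite {z. f (z + x) \<noteq> 0}"
    using fin finite_subset by blast
  then show "\<exists>b\<in>carrier ZwrZ. b \<otimes>\<^bsub>ZwrZ\<^esub> a = \<one>\<^bsub>ZwrZ\<^esub>"
    by (intro bexI[of _ "(\<lambda>z. - f (z + x), - x)"]) (auto simp: a ZwrZ_def)
qed (auto simp: ZwrZ_def algebra_simps)

lemma ZwrZ_generated:
  assumes "g \<in> carrier ZwrZ"
  shows "\<exists>ws. set ws \<subseteq> ZwrZ_gens \<and> foldr (\<otimes>\<^bsub>ZwrZ\<^esub>) ws \<one>\<^bsub>ZwrZ\<^esub> = g"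
proof -
  interpret group ZwrZ by (rule group_ZwrZ)
  define P where "P g \<longleftrightarrow> (\<exists>ws. set ws \<subseteq> ZwrZ_gens \<and> foldr (\<otimes>\<^bsub>ZwrZ\<^esub>) ws \<one>\<^bsub>ZwrZ\<^esub> = g)" for g
  let ?d = "\<lambda>(k::int) (a::int) z. if z = a then k else 0"
  have [simp]: "(f, x) \<otimes>\<^bsub>ZwrZ\<^esub> (h, y) = (\<lambda>z. f z + h (z - x), x + y)" for f x h y
    by (simp add: ZwrZ_def)
  have gens: "ZwrZ_gens \<subseteq> carrier ZwrZ"
    by (auto simp: ZwrZ_gens_def ZwrZ_def)
  have closed: "foldr (\<otimes>\<^bsub>ZwrZ\<^esub>) ws \<one>\<^bsub>ZwrZ\<^esub> \<in> carrier ZwrZ" if "set ws \<subseteq> ZwrZ_gens" for ws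
    using that gens by (induction ws) auto
  have app: "foldr (\<otimes>\<^bsub>ZwrZ\<^esub>) (vs @ ws) \<one>\<^bsub>ZwrZ\<^esub> =
      foldr (\<otimes>\<^bsub>ZwrZ\<^esub>) vs \<one>\<^bsub>ZwrZ\<^esub> \<otimes>\<^bsub>ZwrZ\<^esub> foldr (\<otimes>\<^bsub>ZwrZ\<^esub>) ws \<one>\<^bsub>ZwrZ\<^esub>"
    if "set vs \<subseteq> ZwrZ_gens" "set ws \<subseteq> ZwrZ_gens" for vs ws
    using that(1)
  proof (induction vs)
    case Nil
    then show ?case using closed[OF that(2)] by simp
  next
    case (Cons v vs)
    then have "v \<in> carrier ZwrZ" using gens by auto
    with Cons closed[of vs] closed[OF that(2)] show ?case by (simp add: m_assoc)
  qed
  have mult: "P (a \<otimes>\<^bsub>ZwrZ\<^esub> b)" if "P a" "P b" for a b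
  proof -
    obtain vs ws where "set vs \<subseteq> ZwrZ_gens" "foldr (\<otimes>\<^bsub>ZwrZ\<^esub>) vs \<one>\<^bsub>ZwrZ\<^esub> = a"
      "set ws \<subseteq> ZwrZ_gens" "foldr (\<otimes>\<^bsub>ZwrZ\<^esub>) ws \<one>\<^bsub>ZwrZ\<^esub> = b"
      using \<open>P a\<close> \<open>P b\<close> by (auto simp: P_def)
    then show ?thesis unfolding P_def
      by (intro exI[of _ "vs @ ws"]) (simp only: app set_append Un_subset_iff simp_thms)
  qed
  have one: "P (\<lambda>_. 0, 0)"
    unfolding P_def by (rule exI[of _ "[]"]) (simp add: ZwrZ_def)
  have gen: "P s" if "s \<in> ZwrZ_gens" for s
    unfolding P_def using that gens by (intro exI[of _ "[s]"]) auto
  have shift: "P (\<lambda>_. 0, n)" for n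
  proof (induction n rule: int_induct[where k = 0])
    case base
    show ?case by (rule one)
  next
    case (step1 i)
    then show ?case using mult[OF step1(2) gen[of "(\<lambda>_. 0, 1)"]] by (simp add: ZwrZ_gens_def)
  next
    case (step2 i)
    then show ?case using mult[OF step2(2) gen[of "(\<lambda>_. 0, - 1)"]] by (simp add: ZwrZ_gens_def)
  qed
  have delta0: "P (?d k 0, 0)" for k
  proof (induction k rule: int_induct[where k = 0])
    case base
    show ?case using one by (simp add: if_distrib cong: if_cong)
  next
    case (step1 i)
    have "(\<lambda>z. ?d i 0 z + ?d 1 0 z) = ?d (i + 1) 0" by auto
    then show ?case using mult[OF step1(2) gen[of "(?d 1 0, 0)"]] by (simp add: ZwrZ_gens_def)
  next
    case (step2 i)
    have "(\<lambda>z. ?d i 0 z + ?d (- 1) 0 z) = ?d (i - 1) 0" by auto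
    then show ?case using mult[OF step2(2) gen[of "(?d (- 1) 0, 0)"]] by (simp add: ZwrZ_gens_def)
  qed
  have delta: "P (?d k a, 0)" for k a
    using mult[OF mult[OF shift[of a] delta0[of k]] shift[of "- a"]] by simp
  have lamp: "P (f, 0)" if "finite A" "\<And>z. z \<notin> A \<Longrightarrow> f z = 0" for f A
    using that
  proof (induction A arbitrary: f rule: finite_induct)
    case empty
    then have "f = (\<lambda>_. 0)" by auto
    then show ?case using one by simp
  next
    case (insert a A)
    have "P (f(a := 0), 0)" by (rule insert.IH) (use insert.prems in auto)
    from mult[OF this delta[of a "f a"]] have "P (\<lambda>z. (f(a := 0)) z + ?d (f a) a z, 0)" by simp
    also have "(\<lambda>z. (f(a := 0)) z + ?d (f a) a z) = f" by auto
    finally show ?case .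
  qed
  obtain f x where g: "g = (f, x)" "finite {z. f z \<noteq> 0}"
    using assms by (auto simp: ZwrZ_def)
  have "P (f, 0)" using lamp[OF g(2)] by auto
  from mult[OF this shift[of x]] show ?thesis by (simp add: g P_def)
qed

end

theory Submission
  imports Defs
begin

text \<open>
  An element of the zero section is a finitely supported \<open>f : \<int> \<rightarrow> \<int>\<close>. To get from \<open>f\<close> to \<open>g\<close> with a
  shortest word, the cursor visits every \<open>z\<close> with \<open>f z \<noteq> g z\<close>, changes the value there by
  \<open>\<bar>f z - g z\<bar>\<close> unit steps and returns to \<open>0\<close>. Up to constant factors the distance of \<open>f \<noteq> g\<close> is
  therefore the maximum of \<open>S = \<Sum>\<^sub>z \<bar>f z - g z\<bar>\<close> and \<open>R = max {\<bar>z\<bar> | f z \<noteq> g z}\<close>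
  (\<open>d_ZwrZ_bounds\<close>).

  Upper bound. For \<open>1 \<le> p \<le> 2\<close> any four points of \<open>L\<^sub>p\<close> satisfy
  \<open>\<parallel>a - c\<parallel>\<^sup>p + \<parallel>b - d\<parallel>\<^sup>p \<le> \<parallel>a - b\<parallel>\<^sup>p + \<parallel>b - c\<parallel>\<^sup>p + \<parallel>c - d\<parallel>\<^sup>p + \<parallel>d - a\<parallel>\<^sup>p\<close>
  (\<open>Lp_quadrilateral\<close>), because the numbers do. By induction on the dimension, for every map of a
  discrete cube into \<open>L\<^sub>p\<close> the sum of the \<open>p\<close>-th powers of the diagonals is at most that of the edges,
  that is, \<open>L\<^sub>p\<close> has Enflo type \<open>p\<close> (\<open>cube_diagonals_le_edges\<close>). Take the cube of all functions with
  values in \<open>{0, n}\<close> that are supported in \<open>{0..<n}\<close>. An edge has length \<open>O(n)\<close>, since moving to the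
  lamp and rewriting it cost about the same, while a diagonal has length at least \<open>n\<^sup>2\<close>. A Lipschitz
  map with compression exponent \<open>\<alpha>\<close> thus satisfies \<open>n\<^bsup>2\<alpha>p\<^esup> \<le> C n \<cdot> n\<^sup>p\<close> for all \<open>n\<close>, which forces
  \<open>\<alpha> \<le> (p + 1) / (2p)\<close> (\<open>compression_exponent_le\<close>).

  Lower bound. The exponent is attained by an explicit embedding into an \<open>\<ell>\<^sub>p\<close> space, for which the
  \<open>p\<close>-th power of the distance of the images of \<open>f\<close> and \<open>g\<close> is
  \<open>\<Sum>\<^sub>z (\<bar>k\<^sub>z\<bar>\<^sup>p + \<bar>z\<bar>\<^bsup>p-1\<^esup> \<bar>k\<^sub>z\<bar>)\<close>, where \<open>k\<^sub>z = f z - g z\<close>, plus a term between \<open>R\<^sup>p\<close> and \<open>2R\<^sup>p\<close>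
  (\<open>lamp_embedding\<close>). The last term is possible because \<open>R\<close> is an ultrametric, and the second one
  because \<open>\<bar>k - m\<bar>\<close> is the \<open>p\<close>-th power of an \<open>\<ell>\<^sub>p\<close> distance on \<open>\<int>\<close>. All three terms are \<open>O(d\<^sup>p)\<close>,
  so the map is Lipschitz. For the compression, let \<open>\<lambda> = \<surd>S / 4\<close>. The lamps with \<open>\<bar>z\<bar> \<le> \<lambda>\<close> and
  \<open>\<bar>k\<^sub>z\<bar> \<le> \<lambda>\<close> account for at most half of \<open>S\<close>, and every other lamp contributes at least
  \<open>\<lambda>\<^bsup>p-1\<^esup> \<bar>k\<^sub>z\<bar>\<close>. The total is at least \<open>\<lambda>\<^bsup>p-1\<^esup> S / 2\<close>, which is of order \<open>S\<^bsup>(p+1)/2\<^esup>\<close>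
  (\<open>lamp_kernel_ge\<close>). The weight \<open>\<bar>z\<bar>\<^bsup>p-1\<^esup>\<close> matters for differences that are spread over many lamps,
  the power \<open>\<bar>k\<^sub>z\<bar>\<^sup>p\<close> for those concentrated on few. When \<open>R\<close> is larger than \<open>S\<close>, the term \<open>R\<^sup>p\<close> suffices,
  as \<open>(p + 1) / 2 \<le> p\<close>.
\<close>

section \<open>The quadrilateral inequality for powers of the absolute value\<close>

lemma powr_increment_antimono:
  fixes q s t w :: real
  assumes q: "0 \<le> q" "q \<le> 1" and st: "0 < s" "s \<le> t" and w: "0 \<le> w"
  shows "(t + w) powr q - t powr q \<le> (s + w) powr q - s powr q"
proof (rule DERIV_nonpos_imp_nonincreasing[OF st(2)])
  fix x assume x: "s \<le> x" "x \<le> t"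
  have "(x + w) powr (q - 1) \<le> x powr (q - 1)"
    using x st w q by (intro powr_mono2') auto
  then have "q * (x + w) powr (q - 1) - q * x powr (q - 1) \<le> 0"
    using q by (simp add: mult_left_mono)
  moreover have "((\<lambda>x. (x + w) powr q - x powr q) has_real_derivative
      q * (x + w) powr (q - 1) - q * x powr (q - 1)) (at x)"
    using x st w by (auto intro!: derivative_eq_intros)
  ultimately show "\<exists>y. ((\<lambda>x. (x + w) powr q - x powr q) has_real_derivative y) (at x) \<and> y \<le> 0"
    by blast
qed

lemma powr_increment_mono:
  fixes q s t w :: real
  assumes q: "1 \<le> q" and st: "0 \<le> s" "s \<le> t" and w: "0 \<le> w"
  shows "(s + w) powr q - s powr q \<le> (t + w) powr q - t powr q"
proof (rule DERIV_nonneg_imp_increasing_open[OF st(2)])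
  fix x assume x: "s < x" "x < t"
  have "x powr (q - 1) \<le> (x + w) powr (q - 1)"
    using x st w q by (intro powr_mono2) auto
  then have "0 \<le> q * (x + w) powr (q - 1) - q * x powr (q - 1)"
    using q by (simp add: mult_left_mono)
  moreover have "((\<lambda>x. (x + w) powr q - x powr q) has_real_derivative
      q * (x + w) powr (q - 1) - q * x powr (q - 1)) (at x)"
    using x st w by (auto intro!: derivative_eq_intros)
  ultimately show "\<exists>y. ((\<lambda>x. (x + w) powr q - x powr q) has_real_derivative y) (at x) \<and> 0 \<le> y"
    by blast
next
  show "continuous_on {s..t} (\<lambda>x. (x + w) powr q - x powr q)"
    using q st w by (intro continuous_intros continuous_on_powr') auto
qed

text \<open>The right-hand side is the left-hand side at \<open>v = 0\<close>. The mixed second difference does not increase with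
  \<open>v\<close> because its derivative is, up to the factor \<open>p\<close>, a second difference of the concave function
  \<open>x powr (p - 1)\<close>.\<close>

lemma powr_second_difference_le:
  fixes p u v w :: real
  assumes p: "1 \<le> p" "p \<le> 2" and nonneg: "0 \<le> u" "0 \<le> v" "0 \<le> w"
  shows "(v + u + w) powr p - (v + u) powr p - (v + w) powr p + v powr p
           \<le> (u + w) powr p - u powr p - w powr p"
proof -
  define h where "h x = (x + u + w) powr p - (x + u) powr p - (x + w) powr p + x powr p" for x
  have "h v \<le> h 0"
  proof (rule DERIV_nonpos_imp_decreasing_open[OF nonneg(2)])
    fix x assume x: "0 < x" "x < v"
    have "(h has_real_derivative p * (x + u + w) powr (p - 1) - p * (x + u) powr (p - 1)
        - p * (x + w) powr (p - 1) + p * x powr (p - 1)) (at x)"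
      unfolding h_def using x nonneg by (auto intro!: derivative_eq_intros)
    moreover have "p * (((x + u) + w) powr (p - 1) - (x + u) powr (p - 1)) \<le>
       p * ((x + w) powr (p - 1) - x powr (p - 1))"
      by (intro mult_left_mono powr_increment_antimono) (use x nonneg p in auto)
    ultimately show "\<exists>y. (h has_real_derivative y) (at x) \<and> y \<le> 0"
      by (intro exI conjI) (auto simp: algebra_simps)
  next
    show "continuous_on {0..v} h"
      unfolding h_def using nonneg p by (intro continuous_intros continuous_on_powr') auto
  qed
  then show ?thesis by (simp add: h_def)
qed

lemma powr_add_le_double:
  fixes p u w :: real
  assumes p: "1 \<le> p" "p \<le> 2" and nonneg: "0 \<le> u" "0 \<le> w"
  shows "(u + w) powr p \<le> 2 * (u powr p + w powr p)"
proof (cases "u = 0 \<or> w = 0")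
  case True
  then show ?thesis by auto
next
  case False
  have "((1 - 1/2) *\<^sub>R u + (1/2) *\<^sub>R w) powr p \<le> (1 - 1/2) * u powr p + 1/2 * w powr p"
    by (rule convex_onD[OF powr_convex[OF p(1)]]) (use False nonneg in auto)
  then have "((u + w) / 2) powr p \<le> (u powr p + w powr p) / 2"
    by (simp add: field_simps)
  moreover have "((u + w) / 2) powr p = (u + w) powr p / 2 powr p"
    using nonneg by (simp add: powr_divide)
  ultimately have "(u + w) powr p \<le> 2 powr p * ((u powr p + w powr p) / 2)"
    by (simp add: pos_divide_le_eq mult.commute)
  also have "\<dots> \<le> 2 powr 2 * ((u powr p + w powr p) / 2)"
    using p by (intro mult_right_mono powr_mono) auto
  finally show ?thesis by simp
qed

text \<open>Rotating or reflecting the quadrilateral permutes the terms, so \<open>a\<close> may be taken to be least and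
  \<open>b \<le> d\<close>. For \<open>c \<le> b\<close> monotonicity suffices and for \<open>b \<le> c \<le> d\<close> convexity. When the diagonal
  \<open>b, d\<close> lies inside the diagonal \<open>a, c\<close>, the bound \<open>p \<le> 2\<close> enters: the second difference only grows
  if \<open>b\<close> and \<open>d\<close> are moved together, where the claim becomes \<open>(u + w)\<^sup>p \<le> 2 (u\<^sup>p + w\<^sup>p)\<close>.\<close>

lemma abs_powr_quadrilateral:
  fixes p a b c d :: real
  assumes p: "1 \<le> p" "p \<le> 2"
  shows "\<bar>a - c\<bar> powr p + \<bar>b - d\<bar> powr p \<le>
    \<bar>a - b\<bar> powr p + \<bar>b - c\<bar> powr p + \<bar>c - d\<bar> powr p + \<bar>d - a\<bar> powr p"
proof -
  define Q where "Q a b c d \<longleftrightarrow> \<bar>a - c\<bar> powr p + \<bar>b - d\<bar> powr p \<le>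
    \<bar>a - b\<bar> powr p + \<bar>b - c\<bar> powr p + \<bar>c - d\<bar> powr p + \<bar>d - a\<bar> powr p" for a b c d :: real
  have rot: "Q a b c d \<longleftrightarrow> Q b c d a" and refl: "Q a b c d \<longleftrightarrow> Q a d c b" for a b c d
    by (auto simp: Q_def abs_minus_commute add_ac)
  have least: "Q a b c d" if abd: "a \<le> b" "a \<le> c" "b \<le> d" for a b c d
  proof -
    have ba: "\<bar>a - b\<bar> = b - a" "\<bar>d - a\<bar> = d - a" "\<bar>b - d\<bar> = d - b" "\<bar>a - c\<bar> = c - a"
      using abd by auto
    note pos = powr_ge_zero[of "b - a" p] powr_ge_zero[of "d - a" p] powr_ge_zero[of "b - c" p]
      powr_ge_zero[of "c - d" p] powr_ge_zero[of "d - c" p]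
    consider "c \<le> b" | "b \<le> c" "c \<le> d" | "d \<le> c" using abd by linarith
    then show ?thesis
    proof cases
      case 1
      then have "(c - a) powr p \<le> (b - a) powr p" "(d - b) powr p \<le> (d - c) powr p"
        using abd p by (auto intro!: powr_mono2)
      moreover have "\<bar>b - c\<bar> = b - c" "\<bar>c - d\<bar> = d - c" using 1 abd by auto
      ultimately show ?thesis unfolding Q_def ba using pos by (simp only:)
    next
      case 2
      have "((c - b) + (d - c)) powr p - (c - b) powr p
          \<le> ((c - a) + (d - c)) powr p - (c - a) powr p"
        by (rule powr_increment_mono) (use 2 abd p in auto)
      moreover have "\<bar>b - c\<bar> = c - b" "\<bar>c - d\<bar> = d - c" "(c - b) + (d - c) = d - b"
        "(c - a) + (d - c) = d - a" using 2 abd by auto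
      ultimately show ?thesis unfolding Q_def ba using pos by (simp only:)
    next
      case 3
      have "(c - a) powr p - (d - a) powr p - (c - b) powr p + (d - b) powr p
          \<le> ((b - a) + (c - d)) powr p - (b - a) powr p - (c - d) powr p"
        using powr_second_difference_le[OF p, of "b - a" "d - b" "c - d"] 3 abd by (simp add: algebra_simps)
      also have "((b - a) + (c - d)) powr p \<le> 2 * ((b - a) powr p + (c - d) powr p)"
        by (rule powr_add_le_double) (use 3 abd p in auto)
      finally have "(c - a) powr p + (d - b) powr p
          \<le> (b - a) powr p + (c - b) powr p + (c - d) powr p + (d - a) powr p"
        by simp
      moreover have "\<bar>b - c\<bar> = c - b" "\<bar>c - d\<bar> = c - d" using 3 abd by auto
      ultimately show ?thesis unfolding Q_def ba by (simp only:)
    qed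
  qed
  have min: "Q a b c d" if "a \<le> b" "a \<le> c" "a \<le> d" for a b c d
    using least[of a b c d] least[of a d c b] refl that by (cases "b \<le> d") auto
  consider "a \<le> b" "a \<le> c" "a \<le> d" | "b \<le> a" "b \<le> c" "b \<le> d" | "c \<le> a" "c \<le> b" "c \<le> d"
    | "d \<le> a" "d \<le> b" "d \<le> c" by linarith
  then have "Q a b c d"
    by cases (metis min rot)+
  then show ?thesis by (simp add: Q_def)
qed

section \<open>Diagonals and edges of a cube\<close>

text \<open>Vertices of the cube are subsets of \<open>A\<close>, diagonals join complementary sets, and \<open>D\<close> stands for the
  \<open>p\<close>-th power of a distance. In the step from \<open>A\<close> to \<open>insert a A\<close>, the quadrilateral with vertices
  \<open>x\<close>, \<open>A - x\<close>, \<open>insert a (A - x)\<close>, \<open>insert a x\<close> has two diagonals of the big cube as its diagonals;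
  its sides are one diagonal in each of the two facets and two edges in the new direction. The
  constant is \<open>1\<close>, so nothing is lost in the induction.\<close>

lemma cube_diagonals_le_edges:
  fixes D :: "'b \<Rightarrow> 'b \<Rightarrow> real" and G :: "'a set \<Rightarrow> 'b"
  assumes "finite A"
    and GX: "\<And>x. x \<subseteq> A \<Longrightarrow> G x \<in> X"
    and self: "\<And>u. u \<in> X \<Longrightarrow> D u u = 0"
    and sym: "\<And>u v. u \<in> X \<Longrightarrow> v \<in> X \<Longrightarrow> D u v = D v u"
    and quad: "\<And>a b c d. a \<in> X \<Longrightarrow> b \<in> X \<Longrightarrow> c \<in> X \<Longrightarrow> d \<in> X \<Longrightarrow>
                 D a c + D b d \<le> D a b + D b c + D c d + D d a"
  shows "(\<Sum>x\<in>Pow A. D (G x) (G (A - x))) \<le>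
         (\<Sum>x\<in>Pow A. \<Sum>i\<in>A. D (G x) (G (sym_diff x {i})))"
  using assms(1) GX
proof (induction A arbitrary: G rule: finite_induct)
  case empty
  then show ?case by (simp add: self)
next
  case (insert a A)
  note a = \<open>a \<notin> A\<close> and [simp] = \<open>finite A\<close>
  have X0: "G x \<in> X" and X1: "G (insert a x) \<in> X" if "x \<subseteq> A" for x
    using that insert.prems[of x] insert.prems[of "insert a x"] by auto
  have split: "(\<Sum>x\<in>Pow (insert a A). h x) = (\<Sum>x\<in>Pow A. h x) + (\<Sum>x\<in>Pow A. h (insert a x))"
    for h :: "'a set \<Rightarrow> real"
  proof -
    have "Pow A \<inter> insert a ` Pow A = {}" "inj_on (insert a) (Pow A)"
      using a by (auto simp: inj_on_def)
    then show ?thesis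
      by (simp add: Pow_insert sum.union_disjoint sum.reindex)
  qed
  have compl: "(\<Sum>x\<in>Pow A. h (A - x)) = (\<Sum>x\<in>Pow A. h x)" for h :: "'a set \<Rightarrow> real"
    by (rule sum.reindex_bij_witness[of _ "\<lambda>x. A - x" "\<lambda>x. A - x"]) auto
  let ?e = "\<lambda>x. D (G x) (G (insert a x))"
  have "(\<Sum>x\<in>Pow (insert a A). D (G x) (G (insert a A - x)))
      = (\<Sum>x\<in>Pow A. D (G x) (G (insert a (A - x)))) + (\<Sum>x\<in>Pow A. D (G (insert a x)) (G (A - x)))"
    unfolding split using a
    by (intro arg_cong2[where f = "(+)"] sum.cong refl arg_cong2[where f = D] arg_cong[where f = G]) auto
  also have "\<dots> = (\<Sum>x\<in>Pow A. D (G x) (G (insert a (A - x))) + D (G (A - x)) (G (insert a x)))"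
    unfolding sum.distrib
    by (intro arg_cong2[where f = "(+)"] sum.cong refl sym X0 X1) auto
  also have "\<dots> \<le> (\<Sum>x\<in>Pow A. D (G x) (G (A - x)) + ?e (A - x)
      + D (G (insert a x)) (G (insert a (A - x))) + ?e x)"
  proof (rule sum_mono)
    fix x assume "x \<in> Pow A"
    then have x: "x \<subseteq> A" "A - x \<subseteq> A" by auto
    show "D (G x) (G (insert a (A - x))) + D (G (A - x)) (G (insert a x))
      \<le> D (G x) (G (A - x)) + ?e (A - x) + D (G (insert a x)) (G (insert a (A - x))) + ?e x"
      using quad[OF X0[OF x(1)] X0[OF x(2)] X1[OF x(2)] X1[OF x(1)]]
        sym[OF X1[OF x(1)] X1[OF x(2)]] sym[OF X0[OF x(1)] X1[OF x(1)]] by linarith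
  qed
  also have "\<dots> = (\<Sum>x\<in>Pow A. D (G x) (G (A - x)))
      + (\<Sum>x\<in>Pow A. D (G (insert a x)) (G (insert a (A - x)))) + 2 * (\<Sum>x\<in>Pow A. ?e x)"
    by (simp add: sum.distrib compl[of ?e])
  also have "\<dots> \<le> (\<Sum>x\<in>Pow A. \<Sum>i\<in>A. D (G x) (G (sym_diff x {i})))
      + (\<Sum>x\<in>Pow A. \<Sum>i\<in>A. D (G (insert a x)) (G (insert a (sym_diff x {i}))))
      + 2 * (\<Sum>x\<in>Pow A. ?e x)"
    using insert.IH[of G, OF X0] insert.IH[of "\<lambda>x. G (insert a x)", OF X1] by simp
  also have "\<dots> = (\<Sum>x\<in>Pow (insert a A). \<Sum>i\<in>insert a A. D (G x) (G (sym_diff x {i})))"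
  proof -
    have "(\<Sum>x\<in>Pow A. \<Sum>i\<in>insert a A. D (G x) (G (sym_diff x {i})))
        = (\<Sum>x\<in>Pow A. ?e x + (\<Sum>i\<in>A. D (G x) (G (sym_diff x {i}))))"
    proof (rule sum.cong[OF refl])
      fix x assume "x \<in> Pow A"
      then have "sym_diff x {a} = insert a x" using a by auto
      then show "(\<Sum>i\<in>insert a A. D (G x) (G (sym_diff x {i})))
        = ?e x + (\<Sum>i\<in>A. D (G x) (G (sym_diff x {i})))" using a by simp
    qed
    moreover have "(\<Sum>x\<in>Pow A. \<Sum>i\<in>insert a A. D (G (insert a x)) (G (sym_diff (insert a x) {i})))
        = (\<Sum>x\<in>Pow A. ?e x + (\<Sum>i\<in>A. D (G (insert a x)) (G (insert a (sym_diff x {i})))))"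
    proof (rule sum.cong[OF refl])
      fix x assume "x \<in> Pow A"
      then have x: "x \<subseteq> A" by simp
      have "sym_diff (insert a x) {a} = x" using a x by auto
      moreover have "sym_diff (insert a x) {i} = insert a (sym_diff x {i})" if "i \<in> A" for i
        using a that by auto
      ultimately show "(\<Sum>i\<in>insert a A. D (G (insert a x)) (G (sym_diff (insert a x) {i})))
        = ?e x + (\<Sum>i\<in>A. D (G (insert a x)) (G (insert a (sym_diff x {i}))))"
        using a sym[OF X1[OF x] X0[OF x]] by (simp cong: sum.cong)
    qed
    ultimately show ?thesis by (simp add: split sum.distrib)
  qed
  finally show ?case .
qed

section \<open>The word metric on the zero section\<close>

abbreviation delta :: "int \<Rightarrow> int \<Rightarrow> int" where
  "delta k \<equiv> (\<lambda>z. if z = 0 then k else 0)"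

text \<open>Minimality of the word length is awkward in inductions. This relation, in which \<open>n\<close> need not be
  minimal, is used to build words step by step.\<close>

definition expressible :: "nat \<Rightarrow> (int \<Rightarrow> int) \<times> int \<Rightarrow> bool" where
  "expressible n g \<longleftrightarrow>
     (\<exists>ws. length ws = n \<and> set ws \<subseteq> ZwrZ_gens \<and> foldr (\<otimes>\<^bsub>ZwrZ\<^esub>) ws \<one>\<^bsub>ZwrZ\<^esub> = g)"

lemma ZwrZ_mult [simp]: "(f, x) \<otimes>\<^bsub>ZwrZ\<^esub> (g, y) = (\<lambda>z. f z + g (z - x), x + y)"
  by (simp add: ZwrZ_def)

lemma ZwrZ_one: "\<one>\<^bsub>ZwrZ\<^esub> = (\<lambda>_. 0, 0)"
  by (simp add: ZwrZ_def)

lemma ZwrZ_carrier_iff: "(f, x) \<in> carrier ZwrZ \<longleftrightarrow> finite {z. f z \<noteq> 0}"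
  by (simp add: ZwrZ_def)

lemma expressible_one: "expressible 0 (\<lambda>_. 0, 0)"
  by (simp add: expressible_def ZwrZ_one)

lemma expressible_snoc:
  assumes "expressible n g" "s \<in> ZwrZ_gens"
  shows "expressible (Suc n) (g \<otimes>\<^bsub>ZwrZ\<^esub> s)"
proof -
  interpret group ZwrZ by (rule group_ZwrZ)
  have gens: "ZwrZ_gens \<subseteq> carrier ZwrZ"
    by (auto simp: ZwrZ_gens_def ZwrZ_def)
  obtain ws where ws: "length ws = n" "set ws \<subseteq> ZwrZ_gens" "foldr (\<otimes>\<^bsub>ZwrZ\<^esub>) ws \<one>\<^bsub>ZwrZ\<^esub> = g"
    using assms(1) by (auto simp: expressible_def)
  have s: "s \<in> carrier ZwrZ"
    using gens assms(2) by blast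
  have "foldr (\<otimes>\<^bsub>ZwrZ\<^esub>) ws \<one>\<^bsub>ZwrZ\<^esub> \<in> carrier ZwrZ \<and>
      foldr (\<otimes>\<^bsub>ZwrZ\<^esub>) ws s = foldr (\<otimes>\<^bsub>ZwrZ\<^esub>) ws \<one>\<^bsub>ZwrZ\<^esub> \<otimes>\<^bsub>ZwrZ\<^esub> s"
    using ws(2)
  proof (induction ws)
    case Nil
    then show ?case using s by (simp del: ZwrZ_mult)
  next
    case (Cons a ws)
    then have a: "a \<in> carrier ZwrZ" using gens by auto
    have IH: "foldr (\<otimes>\<^bsub>ZwrZ\<^esub>) ws \<one>\<^bsub>ZwrZ\<^esub> \<in> carrier ZwrZ"
      "foldr (\<otimes>\<^bsub>ZwrZ\<^esub>) ws s = foldr (\<otimes>\<^bsub>ZwrZ\<^esub>) ws \<one>\<^bsub>ZwrZ\<^esub> \<otimes>\<^bsub>ZwrZ\<^esub> s"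
      using Cons by auto
    show ?case
      unfolding foldr.simps comp_apply IH(2) m_assoc[OF a IH(1) s] using a IH(1) by simp
  qed
  then show ?thesis
    unfolding expressible_def using ws assms(2) by (intro exI[of _ "ws @ [s]"]) (simp add: s del: ZwrZ_mult)
qed

lemma expressible_move:
  assumes "expressible n (f, x)"
  shows "expressible (n + nat \<bar>y - x\<bar>) (f, y)"
proof -
  have right: "expressible (n + k) (f, x + int k)" and left: "expressible (n + k) (f, x - int k)" for k
  proof (induction k)
    case (Suc k)
    { case 1
      show ?case using expressible_snoc[OF Suc(1), of "(\<lambda>_. 0, 1)"]
        by (simp add: ZwrZ_gens_def algebra_simps) }
    { case 2
      show ?case using expressible_snoc[OF Suc(2), of "(\<lambda>_. 0, - 1)"]
        by (simp add: ZwrZ_gens_def algebra_simps) }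
  qed (use assms in auto)
  show ?thesis using right[of "nat (y - x)"] left[of "nat (x - y)"]
    by (cases "x \<le> y") (auto simp: abs_if)
qed

lemma expressible_write:
  assumes "expressible n (f, x)"
  shows "expressible (n + nat \<bar>k\<bar>) (f(x := f x + k), x)"
proof -
  have up: "expressible (n + j) (f(x := f x + int j), x)"
    and down: "expressible (n + j) (f(x := f x - int j), x)" for j
  proof (induction j)
    case (Suc j)
    { case 1
      have "(\<lambda>z. (f(x := f x + int j)) z + delta 1 (z - x)) = f(x := f x + int (Suc j))" by auto
      with expressible_snoc[OF Suc(1), of "(delta 1, 0)"] show ?case
        by (simp add: ZwrZ_gens_def del: fun_upd_apply) }
    { case 2
      have "(\<lambda>z. (f(x := f x - int j)) z + delta (- 1) (z - x)) = f(x := f x - int (Suc j))" by auto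
      with expressible_snoc[OF Suc(2), of "(delta (- 1), 0)"] show ?case
        by (simp add: ZwrZ_gens_def del: fun_upd_apply) }
  qed (use assms in auto)
  show ?thesis using up[of "nat k"] down[of "nat (- k)"]
    by (cases "0 \<le> k") (auto simp: abs_if)
qed

text \<open>The cursor first goes to \<open>-r\<close> and then moves to the right, writing the values of \<open>h\<close> on its way.\<close>

lemma expressible_sweep:
  "expressible (r + m + (\<Sum>i<m. nat \<bar>h (int i - int r)\<bar>))
     (\<lambda>z. if - int r \<le> z \<and> z < int m - int r then h z else 0, int m - int r)"
proof (induction m)
  case 0
  have eq: "(\<lambda>z. if - int r \<le> z \<and> z < int 0 - int r then h z else 0) = (\<lambda>_. 0)" by auto
  show ?case unfolding eq using expressible_move[OF expressible_one, of "- int r"] by simp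
next
  case (Suc m)
  let ?x = "int m - int r"
  let ?f = "\<lambda>z. if - int r \<le> z \<and> z < ?x then h z else 0"
  have "?f(?x := ?f ?x + h ?x) = (\<lambda>z. if - int r \<le> z \<and> z < int (Suc m) - int r then h z else 0)"
    by auto
  with expressible_move[OF expressible_write[OF Suc, of "h ?x"], of "?x + 1"]
  show ?case by (simp add: algebra_simps)
qed

lemma word_length_le:
  fixes h :: "int \<Rightarrow> int"
  assumes supp: "\<And>z. h z \<noteq> 0 \<Longrightarrow> \<bar>z\<bar> \<le> int r"
  shows "word_length ZwrZ ZwrZ_gens (h, 0) \<le> 4 * r + 2 + (\<Sum>z\<in>{- int r..int r}. nat \<bar>h z\<bar>)"
proof -
  let ?m = "2 * r + 1"
  have eq: "(\<lambda>z. if - int r \<le> z \<and> z < int ?m - int r then h z else 0) = h"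
    using supp by (force simp: fun_eq_iff)
  have sum_eq: "(\<Sum>i<?m. nat \<bar>h (int i - int r)\<bar>) = (\<Sum>z\<in>{- int r..int r}. nat \<bar>h z\<bar>)"
    by (rule sum.reindex_bij_witness[of _ "\<lambda>z. nat (z + int r)" "\<lambda>i. int i - int r"]) auto
  \<comment> \<open>The sweep over \<open>[-r, r]\<close> leaves the cursor at \<open>r + 1\<close>, from where it returns to \<open>0\<close>.\<close>
  have "r + ?m + S + nat \<bar>0 - (int ?m - int r)\<bar> = 4 * r + 2 + S" for S
    by simp
  with expressible_move[OF expressible_sweep[of r ?m h], of 0, unfolded eq sum_eq]
  have "expressible (4 * r + 2 + (\<Sum>z\<in>{- int r..int r}. nat \<bar>h z\<bar>)) (h, 0)"
    by metis
  then show ?thesis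
    unfolding word_length_def expressible_def by (rule Least_le)
qed

text \<open>One letter moves the cursor by one or changes one lamp by one. In the induction the letter is put in
  front of the word: a move then shifts the whole configuration by one, and a change acts on lamp \<open>0\<close>.\<close>

lemma expressible_bounds:
  assumes "expressible n (h, x)"
  shows "\<bar>x\<bar> \<le> int n" and "h z \<noteq> 0 \<Longrightarrow> \<bar>z\<bar> \<le> int n" and "finite A \<Longrightarrow> (\<Sum>z\<in>A. nat \<bar>h z\<bar>) \<le> n"
proof -
  obtain ws where "length ws = n" "set ws \<subseteq> ZwrZ_gens" "foldr (\<otimes>\<^bsub>ZwrZ\<^esub>) ws \<one>\<^bsub>ZwrZ\<^esub> = (h, x)"
    using assms by (auto simp: expressible_def)
  then have "\<bar>x\<bar> \<le> int n \<and> (\<forall>z. h z \<noteq> 0 \<longrightarrow> \<bar>z\<bar> \<le> int n) \<and>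
      (\<forall>A. finite A \<longrightarrow> (\<Sum>z\<in>A. nat \<bar>h z\<bar>) \<le> n)"
  proof (induction ws arbitrary: n h x)
    case Nil
    then show ?case by (auto simp: ZwrZ_one)
  next
    case (Cons s ws)
    obtain g y where gy: "foldr (\<otimes>\<^bsub>ZwrZ\<^esub>) ws \<one>\<^bsub>ZwrZ\<^esub> = (g, y)" by (rule prod.exhaust)
    define m where "m = length ws"
    have n: "n = Suc m" using Cons.prems by (simp add: m_def)
    have IH: "\<bar>y\<bar> \<le> int m" "\<And>z. g z \<noteq> 0 \<Longrightarrow> \<bar>z\<bar> \<le> int m"
      "\<And>A. finite A \<Longrightarrow> (\<Sum>z\<in>A. nat \<bar>g z\<bar>) \<le> m"
      using Cons.IH[OF _ _ gy, of m] Cons.prems by (auto simp: m_def)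
    have prod: "s \<otimes>\<^bsub>ZwrZ\<^esub> (g, y) = (h, x)" using Cons.prems gy by simp
    have "s \<in> ZwrZ_gens" using Cons.prems by simp
    then have "\<exists>e. \<bar>e\<bar> = 1 \<and> (s = (\<lambda>_. 0, e) \<or> s = (delta e, 0))"
      unfolding ZwrZ_gens_def by (elim insertE emptyE) (rule exI[of _ 1] exI[of _ "- 1"], force)+
    then consider e where "\<bar>e\<bar> = 1" "s = (\<lambda>_. 0, e)" | e where "\<bar>e\<bar> = 1" "s = (delta e, 0)"
      by blast
    then show ?case
    proof cases
      case (1 e)
      then have h: "h = (\<lambda>z. g (z - e))" and x: "x = e + y" using prod by auto
      have "(\<Sum>z\<in>A. nat \<bar>h z\<bar>) = (\<Sum>z\<in>(\<lambda>z. z - e) ` A. nat \<bar>g z\<bar>)" for A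
        by (simp add: h sum.reindex)
      moreover have "\<bar>z\<bar> \<le> int n" if "h z \<noteq> 0" for z
        using IH(2)[of "z - e"] that 1(1) by (simp add: h n)
      ultimately show ?thesis
        using 1(1) IH(1) IH(3) by (auto simp: x n intro: le_SucI)
    next
      case (2 e)
      then have h: "h = (\<lambda>z. delta e z + g z)" and x: "x = y" using prod by auto
      have "(\<Sum>z\<in>A. nat \<bar>h z\<bar>) \<le> n" if "finite A" for A
      proof -
        have "(\<Sum>z\<in>A. nat \<bar>h z\<bar>) \<le> (\<Sum>z\<in>A. (if z = 0 then 1 else 0) + nat \<bar>g z\<bar>)"
          using 2(1) by (intro sum_mono) (auto simp: h)
        also have "\<dots> = (if 0 \<in> A then 1 else 0) + (\<Sum>z\<in>A. nat \<bar>g z\<bar>)"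
          using that by (simp add: sum.distrib)
        also have "\<dots> \<le> n" using IH(3)[OF that] by (simp add: n)
        finally show ?thesis .
      qed
      moreover have "\<bar>z\<bar> \<le> int n" if "h z \<noteq> 0" for z
        using IH(2)[of z] that by (cases "z = 0") (auto simp: h n)
      ultimately show ?thesis using IH(1) by (auto simp: x n)
    qed
  qed
  then show "\<bar>x\<bar> \<le> int n" "h z \<noteq> 0 \<Longrightarrow> \<bar>z\<bar> \<le> int n" "finite A \<Longrightarrow> (\<Sum>z\<in>A. nat \<bar>h z\<bar>) \<le> n"
    by auto
qed

lemma expressible_word_length:
  assumes "finite {z. h z \<noteq> 0}"
  shows "expressible (word_length ZwrZ ZwrZ_gens (h, x)) (h, x)"
proof -
  have "\<exists>n. expressible n (h, x)"
    using ZwrZ_generated[of "(h, x)"] assms by (auto simp: expressible_def ZwrZ_carrier_iff)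
  then show ?thesis
    unfolding word_length_def expressible_def[symmetric] by (rule LeastI_ex)
qed

lemma d_ZwrZ_zero_section:
  assumes "(f, 0) \<in> ZwrZ_zero_section" 
  shows "d_ZwrZ (f, 0) (g, 0) = real (word_length ZwrZ ZwrZ_gens (\<lambda>z. g z - f z, 0))"
proof -
  interpret group ZwrZ by (rule group_ZwrZ)
  have fin: "finite {z. f z \<noteq> 0}"
    using assms by (simp add: ZwrZ_zero_section_def ZwrZ_carrier_iff)
  have "inv\<^bsub>ZwrZ\<^esub> (f, 0) = (\<lambda>z. - f z, 0)"
    by (rule inv_equality) (use fin in \<open>auto simp: ZwrZ_carrier_iff ZwrZ_one\<close>)
  then show ?thesis
    by (simp add: d_ZwrZ_def word_metric_def)
qed

lemma zero_section_iff: "g \<in> ZwrZ_zero_section \<longleftrightarrow> (\<exists>f. g = (f, 0) \<and> finite {z. f z \<noteq> 0})"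
  by (cases g) (auto simp: ZwrZ_zero_section_def ZwrZ_carrier_iff)

lemma d_ZwrZ_self:
  assumes "(f, 0) \<in> ZwrZ_zero_section"
  shows "d_ZwrZ (f, 0) (f, 0) = 0"
proof -
  have "word_length ZwrZ ZwrZ_gens (\<lambda>_. 0, 0) \<le> 0"
    unfolding word_length_def by (rule Least_le) (use expressible_one in \<open>simp add: expressible_def\<close>)
  then show ?thesis by (simp add: d_ZwrZ_zero_section[OF assms])
qed

text \<open>The additive constant in \<open>word_length_le\<close> is absorbed into \<open>3 * S\<close>, since distinct configurations differ
  by at least one unit.\<close>

lemma d_ZwrZ_bounds:
  fixes f g :: "int \<Rightarrow> int" and R :: nat
  defines "S \<equiv> real_of_int (\<Sum>z\<in>{- int R..int R}. \<bar>f z - g z\<bar>)"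
  assumes fin: "finite {z. f z \<noteq> 0}" "finite {z. g z \<noteq> 0}"
    and R: "\<And>z. f z \<noteq> g z \<Longrightarrow> \<bar>z\<bar> \<le> int R" "\<exists>z. f z \<noteq> g z \<and> \<bar>z\<bar> = int R"
  shows "1 \<le> S" and "S \<le> d_ZwrZ (f, 0) (g, 0)" and "real R \<le> d_ZwrZ (f, 0) (g, 0)"
    and "d_ZwrZ (f, 0) (g, 0) \<le> 4 * real R + 3 * S"
proof -
  let ?A = "{- int R..int R}" and ?h = "\<lambda>z. g z - f z"
  let ?n = "word_length ZwrZ ZwrZ_gens (?h, 0)"
  have "{z. ?h z \<noteq> 0} \<subseteq> {z. f z \<noteq> 0} \<union> {z. g z \<noteq> 0}" by auto
  then have fin_h: "finite {z. ?h z \<noteq> 0}" using fin by (meson finite_UnI finite_subset)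
  have d: "d_ZwrZ (f, 0) (g, 0) = real ?n"
    using fin by (intro d_ZwrZ_zero_section) (auto simp: zero_section_iff)
  have S: "S = real (\<Sum>z\<in>?A. nat \<bar>?h z\<bar>)"
    by (simp add: S_def abs_minus_commute)
  note bounds = expressible_bounds[OF expressible_word_length[OF fin_h, of 0]]
  obtain z where z: "f z \<noteq> g z" "\<bar>z\<bar> = int R" using R(2) by blast
  have "1 \<le> nat \<bar>?h z\<bar>" using z(1) by simp
  also have "\<dots> \<le> (\<Sum>z\<in>?A. nat \<bar>?h z\<bar>)" using z(2) by (intro member_le_sum) auto
  finally have one: "1 \<le> (\<Sum>z\<in>?A. nat \<bar>?h z\<bar>)" .
  then show S1: "1 \<le> S" unfolding S by linarith
  show "S \<le> d_ZwrZ (f, 0) (g, 0)" unfolding S d of_nat_le_iff using bounds(3)[of ?A] by blast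
  show "real R \<le> d_ZwrZ (f, 0) (g, 0)" unfolding d using bounds(2)[of z] z by simp
  have "?n \<le> 4 * R + 2 + (\<Sum>z\<in>?A. nat \<bar>?h z\<bar>)"
    by (rule word_length_le) (use R(1) in force)
  then have "real ?n \<le> 4 * real R + 2 + S" unfolding S by linarith
  with S1 show "d_ZwrZ (f, 0) (g, 0) \<le> 4 * real R + 3 * S" unfolding d by simp
qed

section \<open>The quadrilateral inequality in \<open>L\<^sub>p\<close>\<close>

definition Lp_dist_pow :: "real \<Rightarrow> (real \<Rightarrow> real) \<Rightarrow> (real \<Rightarrow> real) \<Rightarrow> real" where
  "Lp_dist_pow p u v = (LINT t|lebesgue_on {0..1}. \<bar>u t - v t\<bar> powr p)"

lemma Lp_norm_diff_powr:
  assumes "0 < p"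
  shows "Lp_norm p (\<lambda>t. u t - v t) powr p = Lp_dist_pow p u v"
    and "Lp_norm p (\<lambda>t. u t - v t) = Lp_dist_pow p u v powr (1 / p)"
    and "0 \<le> Lp_dist_pow p u v"
  using assms by (auto simp: Lp_norm_def Lp_dist_pow_def powr_powr)

lemma Lp_diff_integrable:
  assumes p: "1 \<le> p" "p \<le> 2" and uv: "u \<in> Lp p" "v \<in> Lp p"
  shows "integrable (lebesgue_on {0..1}) (\<lambda>t. \<bar>u t - v t\<bar> powr p)"
proof (rule Bochner_Integration.integrable_bound)
  have [measurable]: "u \<in> borel_measurable (lebesgue_on {0..1})" "v \<in> borel_measurable (lebesgue_on {0..1})"
    using uv by (auto simp: Lp_def)
  show "integrable (lebesgue_on {0..1}) (\<lambda>t. 2 * (\<bar>u t\<bar> powr p + \<bar>v t\<bar> powr p))"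
    using uv by (auto simp: Lp_def)
  show "(\<lambda>t. \<bar>u t - v t\<bar> powr p) \<in> borel_measurable (lebesgue_on {0..1})"
    by measurable
  show "AE t in lebesgue_on {0..1}. norm (\<bar>u t - v t\<bar> powr p) \<le> norm (2 * (\<bar>u t\<bar> powr p + \<bar>v t\<bar> powr p))"
  proof (rule AE_I2)
    fix t
    have "\<bar>u t - v t\<bar> powr p \<le> (\<bar>u t\<bar> + \<bar>v t\<bar>) powr p"
      using p by (intro powr_mono2) auto
    also have "\<dots> \<le> 2 * (\<bar>u t\<bar> powr p + \<bar>v t\<bar> powr p)"
      using p by (intro powr_add_le_double) auto
    finally show "norm (\<bar>u t - v t\<bar> powr p) \<le> norm (2 * (\<bar>u t\<bar> powr p + \<bar>v t\<bar> powr p))"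
      by simp
  qed
qed

text \<open>The inequality for numbers, integrated over \<open>[0,1]\<close>.\<close>

lemma Lp_quadrilateral:
  assumes p: "1 \<le> p" "p \<le> 2" and mem: "a \<in> Lp p" "b \<in> Lp p" "c \<in> Lp p" "d \<in> Lp p"
  shows "Lp_dist_pow p a c + Lp_dist_pow p b d \<le>
    Lp_dist_pow p a b + Lp_dist_pow p b c + Lp_dist_pow p c d + Lp_dist_pow p d a"
proof -
  note int [simp] = Lp_diff_integrable[OF p]
  have "Lp_dist_pow p a c + Lp_dist_pow p b d
      = (LINT t|lebesgue_on {0..1}. \<bar>a t - c t\<bar> powr p + \<bar>b t - d t\<bar> powr p)"
    using mem by (simp add: Lp_dist_pow_def)
  also have "\<dots> \<le> (LINT t|lebesgue_on {0..1}. \<bar>a t - b t\<bar> powr p + \<bar>b t - c t\<bar> powr p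
      + \<bar>c t - d t\<bar> powr p + \<bar>d t - a t\<bar> powr p)"
    using mem by (intro integral_mono abs_powr_quadrilateral[OF p] Bochner_Integration.integrable_add int)
  also have "\<dots> = Lp_dist_pow p a b + Lp_dist_pow p b c + Lp_dist_pow p c d + Lp_dist_pow p d a"
    using mem by (simp add: Lp_dist_pow_def)
  finally show ?thesis .
qed

section \<open>Upper bound for the exponent\<close>

definition cube_vertex :: "nat \<Rightarrow> int set \<Rightarrow> (int \<Rightarrow> int) \<times> int" where
  "cube_vertex n x = (\<lambda>z. if z \<in> x then int n else 0, 0)"

lemma cube_vertex_zero_section: "finite x \<Longrightarrow> cube_vertex n x \<in> ZwrZ_zero_section"
  by (auto simp: cube_vertex_def zero_section_iff elim: rev_finite_subset)

text \<open>The word visits a lamp at a position below \<open>n\<close>, changes it by \<open>n\<close> and returns. The height \<open>n\<close> of the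
  lamps is chosen so that the cost of travelling does not exceed the order of the cost of writing.\<close>

lemma cube_edge_le:
  assumes n: "1 \<le> n" and x: "x \<subseteq> {0..<int n}" and i: "i \<in> {0..<int n}"
  shows "d_ZwrZ (cube_vertex n x) (cube_vertex n (sym_diff x {i})) \<le> 7 * real n"
proof -
  let ?h = "\<lambda>z. (if z \<in> sym_diff x {i} then int n else 0) - (if z \<in> x then int n else 0)"
  have h: "nat \<bar>?h z\<bar> = (if z = i then n else 0)" for z by auto
  have "word_length ZwrZ ZwrZ_gens (?h, 0) \<le> 4 * n + 2 + (\<Sum>z\<in>{- int n..int n}. nat \<bar>?h z\<bar>)"
    by (rule word_length_le) (use i x in \<open>auto split: if_splits\<close>)
  also have "(\<Sum>z\<in>{- int n..int n}. nat \<bar>?h z\<bar>) = n"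
    unfolding h using i by (subst sum.delta) auto
  finally have "word_length ZwrZ ZwrZ_gens (?h, 0) \<le> 7 * n" using n by simp
  then have "real (word_length ZwrZ ZwrZ_gens (?h, 0)) \<le> 7 * real n" by linarith
  moreover have "d_ZwrZ (cube_vertex n x) (cube_vertex n (sym_diff x {i})) = real (word_length ZwrZ ZwrZ_gens (?h, 0))"
    unfolding cube_vertex_def using cube_vertex_zero_section[of x n] finite_subset[OF x]
    by (intro d_ZwrZ_zero_section) (auto simp: cube_vertex_def)
  ultimately show ?thesis by simp
qed

text \<open>Along a diagonal each of the \<open>n\<close> lamps changes by \<open>n\<close>, so travelling is negligible.\<close>

lemma cube_diagonal_ge:
  assumes x: "x \<subseteq> {0..<int n}"
  shows "(real n)\<^sup>2 \<le> d_ZwrZ (cube_vertex n x) (cube_vertex n ({0..<int n} - x))"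
proof -
  let ?h = "\<lambda>z. (if z \<in> {0..<int n} - x then int n else 0) - (if z \<in> x then int n else 0)"
  have "finite {z. ?h z \<noteq> 0}"
    by (rule finite_subset[of _ "{0..<int n}"]) (use x in auto)
  then have "(\<Sum>z\<in>{0..<int n}. nat \<bar>?h z\<bar>) \<le> word_length ZwrZ ZwrZ_gens (?h, 0)"
    by (intro expressible_bounds(3)[OF expressible_word_length]) auto
  moreover have "(\<Sum>z\<in>{0..<int n}. nat \<bar>?h z\<bar>) = (\<Sum>z\<in>{0..<int n}. n)"
    by (rule sum.cong) auto
  ultimately have "n * n \<le> word_length ZwrZ ZwrZ_gens (?h, 0)" by simp
  then have "real (n * n) \<le> real (word_length ZwrZ ZwrZ_gens (?h, 0))" by linarith
  moreover have "d_ZwrZ (cube_vertex n x) (cube_vertex n ({0..<int n} - x)) = real (word_length ZwrZ ZwrZ_gens (?h, 0))"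
    unfolding cube_vertex_def using cube_vertex_zero_section[of x n] finite_subset[OF x]
    by (intro d_ZwrZ_zero_section) (auto simp: cube_vertex_def)
  ultimately show ?thesis by (simp add: power2_eq_square)
qed

lemma exponent_le_of_powr_bound:
  fixes a b B :: real
  assumes "\<And>n::nat. 1 \<le> n \<Longrightarrow> real n powr a \<le> B * real n powr b"
  shows "a \<le> b"
proof (rule ccontr)
  assume "\<not> a \<le> b"
  then have e: "0 < a - b" by simp
  define n where "n = nat \<lceil>\<bar>B\<bar> powr (1 / (a - b))\<rceil> + 1"
  have n: "1 \<le> n" "\<bar>B\<bar> powr (1 / (a - b)) < real n"
    unfolding n_def by linarith+
  have "\<bar>B\<bar> = (\<bar>B\<bar> powr (1 / (a - b))) powr (a - b)" using e by (simp add: powr_powr)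
  also have "\<dots> < real n powr (a - b)" using e n by (intro powr_less_mono2) auto
  also have "\<dots> = real n powr a / real n powr b" by (simp add: powr_diff)
  also have "\<dots> \<le> B" using assms[OF n(1)] n(1) by (simp add: pos_divide_le_eq)
  finally show False by simp
qed

text \<open>Summing over the \<open>2\<^sup>n\<close> vertices of the cube, diagonals contribute at least \<open>2\<^sup>n (c n\<^bsup>2\<alpha>\<^esup>)\<^sup>p\<close> and edges
  at most \<open>2\<^sup>n n (7 L n)\<^sup>p\<close>.\<close>

lemma compression_exponent_le:
  assumes p: "1 \<le> p" "p \<le> 2" and \<alpha>: "0 \<le> \<alpha>"
    and mem: "\<And>x. x \<in> ZwrZ_zero_section \<Longrightarrow> F x \<in> Lp p"
    and L: "0 \<le> L" "\<And>x y. x \<in> ZwrZ_zero_section \<Longrightarrow> y \<in> ZwrZ_zero_section \<Longrightarrow>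
      Lp_norm p (\<lambda>t. F x t - F y t) \<le> L * d_ZwrZ x y"
    and c: "0 < c" "\<And>x y. x \<in> ZwrZ_zero_section \<Longrightarrow> y \<in> ZwrZ_zero_section \<Longrightarrow>
      c * d_ZwrZ x y powr \<alpha> \<le> Lp_norm p (\<lambda>t. F x t - F y t)"
  shows "\<alpha> \<le> (p + 1) / (2 * p)"
proof -
  have "real n powr (2 * \<alpha> * p) \<le> (7 * L / c) powr p * real n powr (p + 1)" if n: "1 \<le> n" for n :: nat
  proof -
    let ?A = "{0..<int n}" and ?G = "\<lambda>x. F (cube_vertex n x)"
    have ZS: "cube_vertex n x \<in> ZwrZ_zero_section" if "x \<subseteq> ?A" for x
      by (intro cube_vertex_zero_section finite_subset[OF that]) simp
    have "(\<Sum>x\<in>Pow ?A. (c * real n powr (2 * \<alpha>)) powr p)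
        \<le> (\<Sum>x\<in>Pow ?A. Lp_dist_pow p (?G x) (?G (?A - x)))"
    proof (rule sum_mono)
      fix x assume "x \<in> Pow ?A"
      then have x: "x \<subseteq> ?A" "?A - x \<subseteq> ?A" by auto
      have "c * real n powr (2 * \<alpha>) = c * ((real n)\<^sup>2) powr \<alpha>"
      proof -
        have "(real n)\<^sup>2 = real n powr 2" using n by simp
        then show ?thesis by (simp only: powr_powr)
      qed
      also have "\<dots> \<le> c * d_ZwrZ (cube_vertex n x) (cube_vertex n (?A - x)) powr \<alpha>"
        using c(1) \<alpha> cube_diagonal_ge[OF x(1)] by (intro mult_left_mono powr_mono2) auto
      also have "\<dots> \<le> Lp_norm p (\<lambda>t. ?G x t - ?G (?A - x) t)"
        by (intro c(2) ZS x)
      finally show "(c * real n powr (2 * \<alpha>)) powr p \<le> Lp_dist_pow p (?G x) (?G (?A - x))"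
        using p c(1) by (subst Lp_norm_diff_powr(1)[symmetric]) (simp, intro powr_mono2, simp_all)
    qed
    also have "\<dots> \<le> (\<Sum>x\<in>Pow ?A. \<Sum>i\<in>?A. Lp_dist_pow p (?G x) (?G (sym_diff x {i})))"
    proof (rule cube_diagonals_le_edges[where X = "Lp p" and D = "Lp_dist_pow p" and G = ?G])
      show "Lp_dist_pow p u v = Lp_dist_pow p v u" for u v
        by (simp add: Lp_dist_pow_def abs_minus_commute)
    qed (simp_all add: mem ZS Lp_quadrilateral[OF p] Lp_dist_pow_def[of p u u for u])
    also have "\<dots> \<le> (\<Sum>x\<in>Pow ?A. \<Sum>i\<in>?A. (L * (7 * real n)) powr p)"
    proof (intro sum_mono)
      fix x i assume x': "x \<in> Pow ?A" and i: "i \<in> ?A"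
      then have x: "x \<subseteq> ?A" "sym_diff x {i} \<subseteq> ?A" by auto
      have "Lp_norm p (\<lambda>t. ?G x t - ?G (sym_diff x {i}) t)
          \<le> L * d_ZwrZ (cube_vertex n x) (cube_vertex n (sym_diff x {i}))"
        by (intro L(2) ZS x)
      also have "\<dots> \<le> L * (7 * real n)"
        by (intro mult_left_mono cube_edge_le n x i L(1))
      finally show "Lp_dist_pow p (?G x) (?G (sym_diff x {i})) \<le> (L * (7 * real n)) powr p"
        using p by (subst Lp_norm_diff_powr(1)[symmetric]) (simp, intro powr_mono2, simp_all add: Lp_norm_def)
    qed
    finally have "(c * real n powr (2 * \<alpha>)) powr p \<le> real n * (L * (7 * real n)) powr p"
      by (simp add: card_Pow)
    moreover have "(c * real n powr (2 * \<alpha>)) powr p = c powr p * real n powr (2 * \<alpha> * p)"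
      using c(1) by (simp add: powr_mult powr_powr)
    moreover have "real n * (L * (7 * real n)) powr p = (7 * L) powr p * real n powr (p + 1)"
    proof -
      have "L * (7 * real n) = (7 * L) * real n" by simp
      then have "(L * (7 * real n)) powr p = (7 * L) powr p * real n powr p"
        by (simp only: powr_mult)
      then show ?thesis using n by (simp add: powr_add)
    qed
    moreover have "(7 * L / c) powr p = (7 * L) powr p / c powr p"
      by (rule powr_divide)
    ultimately show ?thesis
      using c(1) by (simp add: pos_le_divide_eq mult.commute)
  qed
  then have "2 * \<alpha> * p \<le> p + 1" by (rule exponent_le_of_powr_bound)
  then show ?thesis using p by (simp add: pos_le_divide_eq mult.commute mult.left_commute)
qed

section \<open>Sequence spaces inside \<open>L\<^sub>p([0,1])\<close>\<close>

text \<open>Coordinate \<open>i\<close> is realised by the indicator of an interval \<open>J i\<close>, scaled to have norm one; the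
  intervals are disjoint, so the \<open>p\<close>-th powers of the coordinates add up. The set \<open>A\<close> in the
  conclusion is arbitrary, which spares its users from determining exactly where \<open>X x\<close> and \<open>X y\<close> differ.\<close>

lemma finitely_supported_into_Lp:
  fixes X :: "'x \<Rightarrow> 'i \<Rightarrow> real"
  assumes p: "1 \<le> p" and I: "countable I"
    and supp: "\<And>x. x \<in> S \<Longrightarrow> finite {i. X x i \<noteq> 0}" "\<And>x i. x \<in> S \<Longrightarrow> X x i \<noteq> 0 \<Longrightarrow> i \<in> I"
  obtains F where "\<And>x. x \<in> S \<Longrightarrow> F x \<in> Lp p"
    and "\<And>x y A. x \<in> S \<Longrightarrow> y \<in> S \<Longrightarrow> finite A \<Longrightarrow> (\<And>i. i \<notin> A \<Longrightarrow> X x i = X y i) \<Longrightarrow>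
           Lp_dist_pow p (F x) (F y) = (\<Sum>i\<in>A. \<bar>X x i - X y i\<bar> powr p)"
proof -
  define J where "J i = {1 / (real (to_nat_on I i) + 2)<..1 / (real (to_nat_on I i) + 1)}" for i
  define l where "l i = 1 / (real (to_nat_on I i) + 1) - 1 / (real (to_nat_on I i) + 2)" for i
  define e where "e i t = l i powr (- 1 / p) * indicator (J i) t" for i t
  define step where "step a t = (\<Sum>i\<in>{i. a i \<noteq> 0}. a i * e i t)" for a :: "'i \<Rightarrow> real" and t
  have l_pos: "0 < l i" for i
    by (simp add: l_def frac_less2)
  have J_sub: "J i \<subseteq> {0..1}" for i
  proof
    fix t assume "t \<in> J i"
    moreover have "0 \<le> 1 / (real (to_nat_on I i) + 2)" "1 / (real (to_nat_on I i) + 1) \<le> 1" by simp_all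
    ultimately show "t \<in> {0..1}" unfolding J_def greaterThanAtMost_iff atLeastAtMost_iff by linarith
  qed
  have J_sets [measurable]: "J i \<in> sets (lebesgue_on {0..1})" for i
    using J_sub by (simp add: sets_restrict_space_iff) (simp add: J_def)
  have J_measure: "measure (lebesgue_on {0..1}) (J i) = l i" for i
    using J_sub l_pos[of i] by (simp add: measure_restrict_space) (simp add: J_def l_def)
  have J_integrable: "integrable (lebesgue_on {0..1}) (indicator (J i) :: real \<Rightarrow> real)" for i
  proof -
    interpret finite_measure "lebesgue_on {0..1::real}"
      by (rule finite_measure_lebesgue_on) simp
    show ?thesis by (simp add: integrable_indicator_iff less_top[symmetric] Int_absorb2[OF J_sub] J_sets)
  qed
  have J_disjoint: "t \<notin> J j" if t: "t \<in> J i" and ij: "i \<in> I" "j \<in> I" "i \<noteq> j" for i j t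
  proof
    assume tj: "t \<in> J j"
    have "to_nat_on I i \<noteq> to_nat_on I j"
      using ij I by simp
    moreover have False if "m < n" "1 / (real m + 2) < t" "t \<le> 1 / (real n + 1)" for m n :: nat
    proof -
      have "1 / (real n + 1) \<le> 1 / (real m + 2)" using that(1) by (intro divide_left_mono) auto
      with that show False by linarith
    qed
    ultimately show False
      using t tj unfolding J_def by (cases "to_nat_on I i" "to_nat_on I j" rule: linorder_cases) auto
  qed
  have step_eq: "step a t = (\<Sum>i\<in>A. a i * e i t)"
    if "finite A" "\<And>i. i \<notin> A \<Longrightarrow> a i = 0" for a A t
    unfolding step_def using that by (intro sum.mono_neutral_left) auto
  \<comment> \<open>At most one of the functions \<open>e i\<close> is nonzero at \<open>t\<close>.\<close>
  have powr_step: "\<bar>\<Sum>i\<in>A. a i * e i t\<bar> powr p = (\<Sum>i\<in>A. \<bar>a i\<bar> powr p / l i * indicator (J i) t)"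
    if A: "finite A" "A \<subseteq> I" for a A t
  proof (cases "\<exists>i\<in>A. t \<in> J i")
    case True
    then obtain i where i: "i \<in> A" "t \<in> J i" by blast
    have other: "t \<notin> J j" if "j \<in> A - {i}" for j
      using J_disjoint[OF i(2), of j] that A(2) i(1) by auto
    have "(\<Sum>j\<in>A. a j * e j t) = a i * e i t"
      using other by (subst sum.remove[OF A(1) i(1)]) (simp add: e_def)
    moreover have "(\<Sum>j\<in>A. \<bar>a j\<bar> powr p / l j * indicator (J j) t) = \<bar>a i\<bar> powr p / l i"
      using other i by (subst sum.remove[OF A(1) i(1)]) simp
    moreover have "\<bar>a i * e i t\<bar> powr p = \<bar>a i\<bar> powr p / l i"
    proof -
      have "(l i powr (- 1 / p)) powr p = l i powr (- 1)" using p by (simp only: powr_powr) simp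
      then have "(l i powr (- 1 / p)) powr p = 1 / l i" using l_pos[of i] by (simp add: powr_minus_divide)
      moreover have "\<bar>a i * e i t\<bar> = \<bar>a i\<bar> * l i powr (- 1 / p)" using i by (simp add: e_def abs_mult)
      ultimately show ?thesis by (simp add: powr_mult)
    qed
    ultimately show ?thesis by simp
  next
    case False
    then show ?thesis by (simp add: e_def)
  qed
  have int_step: "integrable (lebesgue_on {0..1}) (\<lambda>t. \<bar>\<Sum>i\<in>A. a i * e i t\<bar> powr p)"
    and LINT_step: "(LINT t|lebesgue_on {0..1}. \<bar>\<Sum>i\<in>A. a i * e i t\<bar> powr p) = (\<Sum>i\<in>A. \<bar>a i\<bar> powr p)"
    if "finite A" "A \<subseteq> I" for a A
    unfolding powr_step[OF that] using J_integrable l_pos[THEN less_imp_neq]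
    by (auto simp: J_measure Int_absorb2[OF J_sub] intro!: sum.cong)
  show thesis
  proof (rule that[of "\<lambda>x. step (X x)"])
    fix x assume x: "x \<in> S"
    let ?A = "{i. X x i \<noteq> 0}"
    have [measurable]: "step (X x) \<in> borel_measurable (lebesgue_on {0..1})"
      unfolding step_def e_def by measurable
    show "step (X x) \<in> Lp p"
      using int_step[of ?A "X x"] supp[OF x] by (auto simp: Lp_def step_def)
  next
    fix x y A assume x: "x \<in> S" and y: "y \<in> S" and A: "finite A" "\<And>i. i \<notin> A \<Longrightarrow> X x i = X y i"
    define B where "B = {i. X x i \<noteq> 0} \<union> {i. X y i \<noteq> 0}"
    have B: "finite B" "B \<subseteq> I"
      using supp[OF x] supp[OF y] by (auto simp: B_def)
    have "step (X x) t - step (X y) t = (\<Sum>i\<in>B. (X x i - X y i) * e i t)" for t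
      by (subst (1 2) step_eq[OF B(1)]) (auto simp: B_def sum_subtractf algebra_simps)
    then have "Lp_dist_pow p (step (X x)) (step (X y)) = (\<Sum>i\<in>B. \<bar>X x i - X y i\<bar> powr p)"
      unfolding Lp_dist_pow_def by (simp add: LINT_step[OF B])
    also have "\<dots> = (\<Sum>i\<in>A \<inter> B. \<bar>X x i - X y i\<bar> powr p)"
      using B(1) A p by (intro sum.mono_neutral_right) auto
    also have "\<dots> = (\<Sum>i\<in>A. \<bar>X x i - X y i\<bar> powr p)"
      using A(1) p by (intro sum.mono_neutral_left) (auto simp: B_def)
    finally show "Lp_dist_pow p (step (X x)) (step (X y)) = (\<Sum>i\<in>A. \<bar>X x i - X y i\<bar> powr p)" .
  qed
qed

section \<open>Coordinates of the embedding\<close>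

text \<open>The signed indicator of the integers between \<open>0\<close> and \<open>k\<close>. The functions of \<open>k\<close> and of \<open>m\<close> differ by one
  at exactly \<open>\<bar>k - m\<bar>\<close> places, which turns \<open>\<bar>k - m\<bar>\<close> into the \<open>p\<close>-th power of an \<open>\<ell>\<^sub>p\<close> distance for every
  \<open>p\<close>. The sign makes the support finite also for negative \<open>k\<close>.\<close>

definition level :: "int \<Rightarrow> int \<Rightarrow> real" where
  "level k j = (if 0 < j \<and> j \<le> k then 1 else if k < j \<and> j \<le> 0 then - 1 else 0)"

lemma level_diff: "\<bar>level k j - level m j\<bar> = (if j \<in> {min k m<..max k m} then 1 else 0)"
  by (auto simp: level_def)

text \<open>The restriction of \<open>f\<close> to the complement of \<open>[-r, r]\<close>, given as a graph: for finitely supported \<open>f\<close> this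
  is a finite set of pairs of integers, and there are only countably many of those.\<close>

definition tail :: "(int \<Rightarrow> int) \<Rightarrow> nat \<Rightarrow> (int \<times> int) set" where
  "tail f r = {(z, f z) | z. int r < \<bar>z\<bar> \<and> f z \<noteq> 0}"

text \<open>The three kinds of coordinates record the value of a lamp, its levels, and the tails of \<open>f\<close>. A
  coordinate of weight \<open>w\<close> carries the factor \<open>w powr (1 / p)\<close>, so that it contributes \<open>w\<close> to the \<open>p\<close>-th
  power of the norm. The tails of \<open>f\<close> and \<open>g\<close> differ precisely for \<open>r < R\<close>, and the weights
  \<open>(r + 1)\<^sup>p - r\<^sup>p\<close> telescope to \<open>R\<^sup>p\<close>. The empty tail is left out to keep the support finite.\<close>

definition lamp_coords :: "real \<Rightarrow> (int \<Rightarrow> int) \<Rightarrow> int + int \<times> int + nat \<times> (int \<times> int) set \<Rightarrow> real" where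
  "lamp_coords p f = case_sum (\<lambda>z. real_of_int (f z))
     (case_sum (\<lambda>(z, j). (\<bar>real_of_int z\<bar> powr (p - 1)) powr (1 / p) * level (f z) j)
        (\<lambda>(r, T). ((real r + 1) powr p - real r powr p) powr (1 / p) * (if T \<noteq> {} \<and> T = tail f r then 1 else 0)))"

lemma lamp_coords_simps:
  "lamp_coords p f (Inl z) = real_of_int (f z)"
  "lamp_coords p f (Inr (Inl (z, j))) = (\<bar>real_of_int z\<bar> powr (p - 1)) powr (1 / p) * level (f z) j"
  "lamp_coords p f (Inr (Inr (r, T))) =
     ((real r + 1) powr p - real r powr p) powr (1 / p) * (if T \<noteq> {} \<and> T = tail f r then 1 else 0)"
  by (simp_all add: lamp_coords_def)

lemma coord_cases:
  obtains (lamp) z where "i = Inl z" | (level) z j where "i = Inr (Inl (z, j))"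
    | (tail) r T where "i = Inr (Inr (r, T))"
  by (metis sum.exhaust prod.exhaust)

text \<open>The contribution of lamp values and levels to the \<open>p\<close>-th power of the distance.\<close>

definition lamp_kernel :: "real \<Rightarrow> nat \<Rightarrow> (int \<Rightarrow> int) \<Rightarrow> real" where
  "lamp_kernel p R h = (\<Sum>z\<in>{- int R..int R}. \<bar>real_of_int (h z)\<bar> powr p
      + \<bar>real_of_int z\<bar> powr (p - 1) * \<bar>real_of_int (h z)\<bar>)"

lemma finite_tail:
  assumes "finite {z. f z \<noteq> 0}"
  shows "finite (tail f r)"
  by (rule finite_subset[of _ "(\<lambda>z. (z, f z)) ` {z. f z \<noteq> 0}"]) (use assms in \<open>auto simp: tail_def\<close>)

lemma tail_eq_iff: "tail f r = tail g r \<longleftrightarrow> (\<forall>z. int r < \<bar>z\<bar> \<longrightarrow> f z = g z)"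
proof
  assume eq: "tail f r = tail g r"
  show "\<forall>z. int r < \<bar>z\<bar> \<longrightarrow> f z = g z"
  proof (intro allI impI)
    fix z assume z: "int r < \<bar>z\<bar>"
    have "(z, f z) \<in> tail f r \<longleftrightarrow> f z \<noteq> 0" "(z, f z) \<in> tail g r \<longleftrightarrow> g z \<noteq> 0 \<and> f z = g z"
      "(z, g z) \<in> tail f r \<longleftrightarrow> f z \<noteq> 0 \<and> f z = g z" "(z, g z) \<in> tail g r \<longleftrightarrow> g z \<noteq> 0"
      using z by (auto simp: tail_def)
    with eq show "f z = g z" by metis
  qed
qed (auto simp: tail_def)

lemma exists_int_support_bound:
  fixes P :: "int \<Rightarrow> bool"
  assumes "finite {z. P z}"
  obtains R :: nat where "\<And>z. P z \<Longrightarrow> \<bar>z\<bar> \<le> int R" and "Ex P \<Longrightarrow> \<exists>z. P z \<and> \<bar>z\<bar> = int R"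
proof -
  let ?A = "(\<lambda>z. nat \<bar>z\<bar>) ` {z. P z}"
  show thesis
  proof (cases "Ex P")
    case True
    then have A: "finite ?A" "?A \<noteq> {}" using assms by auto
    show thesis
    proof (rule that[of "Max ?A"])
      fix z assume "P z"
      then have "nat \<bar>z\<bar> \<le> Max ?A" using A by (intro Max_ge) auto
      then show "\<bar>z\<bar> \<le> int (Max ?A)" by linarith
    next
      show "\<exists>z. P z \<and> \<bar>z\<bar> = int (Max ?A)" using Max_in[OF A] by auto
    qed
  qed (use that[of 0] in auto)
qed

lemma finite_support_lamp_coords:
  assumes "finite {z. f z \<noteq> 0}"
  shows "finite {i. lamp_coords p f i \<noteq> 0}"
proof -
  obtain R :: nat where R: "\<And>z. f z \<noteq> 0 \<Longrightarrow> \<bar>z\<bar> \<le> int R"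
    using exists_int_support_bound[OF assms] by blast
  have "tail f r = {}" if "R \<le> r" for r
    using R that by (force simp: tail_def)
  then have tail: "r < R" if "e \<in> tail f r" for e r
    using that not_le by blast
  have "i \<in> {z. f z \<noteq> 0} <+>
      ((SIGMA z:{z. f z \<noteq> 0}. {- \<bar>f z\<bar>..\<bar>f z\<bar>}) <+> (\<lambda>r. (r, tail f r)) ` {..<R})"
    if "lamp_coords p f i \<noteq> 0" for i
    using that by (cases i rule: coord_cases)
      (auto simp: lamp_coords_simps level_def tail split: if_splits)
  then have "{i. lamp_coords p f i \<noteq> 0} \<subseteq> {z. f z \<noteq> 0} <+>
      ((SIGMA z:{z. f z \<noteq> 0}. {- \<bar>f z\<bar>..\<bar>f z\<bar>}) <+> (\<lambda>r. (r, tail f r)) ` {..<R})"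
    by blast
  then show ?thesis
    by (rule finite_subset) (use assms in \<open>auto intro!: finite_Plus\<close>)
qed

text \<open>Where \<open>f\<close> and \<open>g\<close> have different tails, each of the two tails contributes its weight once unless it is
  empty. At most one of them is empty, which gives the factor between \<open>1\<close> and \<open>2\<close>.\<close>

lemma lamp_embedding:
  assumes p: "1 \<le> p"
  obtains F where "\<And>f. finite {z. f z \<noteq> 0} \<Longrightarrow> F f \<in> Lp p"
    and "\<And>f g R. finite {z. f z \<noteq> 0} \<Longrightarrow> finite {z. g z \<noteq> 0} \<Longrightarrow>
      (\<And>z. f z \<noteq> g z \<Longrightarrow> \<bar>z\<bar> \<le> int R) \<Longrightarrow> (\<exists>z. f z \<noteq> g z \<and> \<bar>z\<bar> = int R) \<Longrightarrow>
      lamp_kernel p R (\<lambda>z. f z - g z) + real R powr p \<le> Lp_dist_pow p (F f) (F g) \<and>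
      Lp_dist_pow p (F f) (F g) \<le> lamp_kernel p R (\<lambda>z. f z - g z) + 2 * real R powr p"
proof -
  let ?S = "{f :: int \<Rightarrow> int. finite {z. f z \<noteq> 0}}"
  let ?I = "UNIV <+> (UNIV <+> UNIV \<times> Collect finite) :: (int + int \<times> int + nat \<times> (int \<times> int) set) set"
  have "countable ?I"
    by (intro countable_Plus countable_SIGMA countable_Collect_finite uncountable_def) auto
  moreover have "i \<in> ?I" if "f \<in> ?S" "lamp_coords p f i \<noteq> 0" for f i
    using that by (cases i rule: coord_cases) (auto simp: lamp_coords_simps finite_tail split: if_splits)
  moreover have "finite {i. lamp_coords p f i \<noteq> 0}" if "f \<in> ?S" for f
    using that by (intro finite_support_lamp_coords) simp
  ultimately obtain F where F: "\<And>f. f \<in> ?S \<Longrightarrow> F f \<in> Lp p"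
    "\<And>f g A. f \<in> ?S \<Longrightarrow> g \<in> ?S \<Longrightarrow> finite A \<Longrightarrow> (\<And>i. i \<notin> A \<Longrightarrow> lamp_coords p f i = lamp_coords p g i) \<Longrightarrow>
       Lp_dist_pow p (F f) (F g) = (\<Sum>i\<in>A. \<bar>lamp_coords p f i - lamp_coords p g i\<bar> powr p)"
    using finitely_supported_into_Lp[OF p, of ?I ?S "lamp_coords p"] by blast
  show thesis
  proof (rule that[of F])
    fix f :: "int \<Rightarrow> int" assume "finite {z. f z \<noteq> 0}"
    then show "F f \<in> Lp p" by (intro F) simp
  next
    fix f g :: "int \<Rightarrow> int" and R :: nat
    assume fin: "finite {z. f z \<noteq> 0}" "finite {z. g z \<noteq> 0}"
      and R: "\<And>z. f z \<noteq> g z \<Longrightarrow> \<bar>z\<bar> \<le> int R" "\<exists>z. f z \<noteq> g z \<and> \<bar>z\<bar> = int R"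
    let ?A1 = "{- int R..int R}"
    let ?A2 = "SIGMA z:?A1. {min (f z) (g z)<..max (f z) (g z)}"
    let ?A3 = "SIGMA r:{..<R}. {tail f r, tail g r}"
    let ?D = "\<lambda>i. \<bar>lamp_coords p f i - lamp_coords p g i\<bar> powr p"
    have scale: "\<bar>w powr (1 / p) * x - w powr (1 / p) * y\<bar> powr p = w * \<bar>x - y\<bar> powr p" if "0 \<le> w" for w x y :: real
      using p that by (simp add: abs_mult powr_mult powr_powr flip: right_diff_distrib)
    have tails: "tail f r = tail g r \<longleftrightarrow> R \<le> r" for r
    proof
      assume eq: "tail f r = tail g r"
      obtain z where z: "f z \<noteq> g z" "\<bar>z\<bar> = int R" using R(2) by blast
      then have "\<not> int r < \<bar>z\<bar>" using eq[unfolded tail_eq_iff] by blast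
      then show "R \<le> r" using z by simp
    next
      assume "R \<le> r"
      then have "f z = g z" if "int r < \<bar>z\<bar>" for z using R(1)[of z] that by force
      then show "tail f r = tail g r" by (simp add: tail_eq_iff)
    qed
    have "Lp_dist_pow p (F f) (F g) = (\<Sum>i\<in>?A1 <+> (?A2 <+> ?A3). ?D i)"
    proof (rule F(2))
      fix i assume i: "i \<notin> ?A1 <+> (?A2 <+> ?A3)"
      have agree: "f z = g z" if "z \<notin> ?A1" for z
        using R(1)[of z] that by (cases "f z = g z") auto
      show "lamp_coords p f i = lamp_coords p g i"
      proof (cases i rule: coord_cases)
        case (lamp z)
        then have "z \<notin> ?A1" using i by auto
        then show ?thesis by (simp add: lamp lamp_coords_simps agree)
      next
        case (level z j)
        then have "z \<notin> ?A1 \<or> j \<notin> {min (f z) (g z)<..max (f z) (g z)}" using i by auto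
        then have "level (f z) j = level (g z) j"
          using agree[of z] level_diff[of "f z" j "g z"] by (auto split: if_splits)
        then show ?thesis by (simp add: level lamp_coords_simps)
      next
        case (tail r T)
        then have "R \<le> r \<or> T \<noteq> tail f r \<and> T \<noteq> tail g r" using i by auto
        then show ?thesis using tails[of r] by (auto simp: tail lamp_coords_simps)
      qed
    qed (use fin in auto)
    also have "\<dots> = (\<Sum>z\<in>?A1. \<bar>real_of_int (f z - g z)\<bar> powr p)
        + ((\<Sum>(z, j)\<in>?A2. ?D (Inr (Inl (z, j)))) + (\<Sum>(r, T)\<in>?A3. ?D (Inr (Inr (r, T)))))"
    proof -
      have fin: "finite ?A1" "finite ?A2" "finite ?A3" by auto
      show ?thesis
        using fin by (simp add: sum.Plus lamp_coords_simps(1) case_prod_unfold)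
    qed
    also have "(\<Sum>(z, j)\<in>?A2. ?D (Inr (Inl (z, j)))) =
        (\<Sum>z\<in>?A1. \<bar>real_of_int z\<bar> powr (p - 1) * \<bar>real_of_int (f z - g z)\<bar>)"
    proof -
      have "(\<Sum>(z, j)\<in>?A2. ?D (Inr (Inl (z, j)))) =
        (\<Sum>z\<in>?A1. \<Sum>j\<in>{min (f z) (g z)<..max (f z) (g z)}. ?D (Inr (Inl (z, j))))"
        by (subst sum.Sigma) auto
      also have "\<dots> = (\<Sum>z\<in>?A1. \<bar>real_of_int z\<bar> powr (p - 1) * \<bar>real_of_int (f z - g z)\<bar>)"
      proof (rule sum.cong[OF refl])
        fix z
        have "(\<Sum>j\<in>{min (f z) (g z)<..max (f z) (g z)}. ?D (Inr (Inl (z, j)))) =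
            (\<Sum>j\<in>{min (f z) (g z)<..max (f z) (g z)}. \<bar>real_of_int z\<bar> powr (p - 1))"
          by (rule sum.cong[OF refl]) (simp add: lamp_coords_simps scale level_diff)
        also have "\<dots> = \<bar>real_of_int z\<bar> powr (p - 1) * \<bar>real_of_int (f z - g z)\<bar>"
          by (simp add: min_def max_def abs_if)
        finally show "(\<Sum>j\<in>{min (f z) (g z)<..max (f z) (g z)}. ?D (Inr (Inl (z, j)))) = \<dots>" .
      qed
      finally show ?thesis .
    qed
    finally have split: "Lp_dist_pow p (F f) (F g) = lamp_kernel p R (\<lambda>z. f z - g z)
        + (\<Sum>(r, T)\<in>?A3. ?D (Inr (Inr (r, T))))"
      by (simp add: lamp_kernel_def sum.distrib)
    define w where "w r = (real r + 1) powr p - real r powr p" for r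
    have w: "0 \<le> w r" for r
      using p by (simp add: w_def powr_mono2)
    have sum_w: "(\<Sum>r<R. w r) = real R powr p"
      using p sum_lessThan_telescope[of "\<lambda>r. real r powr p" R] by (simp add: w_def add.commute)
    have row: "w r \<le> (\<Sum>T\<in>{tail f r, tail g r}. ?D (Inr (Inr (r, T)))) \<and>
        (\<Sum>T\<in>{tail f r, tail g r}. ?D (Inr (Inr (r, T)))) \<le> 2 * w r" if "r < R" for r
    proof -
      have "tail f r \<noteq> tail g r" using tails[of r] that by simp
      moreover have "?D (Inr (Inr (r, T))) = w r * \<bar>(if T \<noteq> {} \<and> T = tail f r then 1 else 0)
          - (if T \<noteq> {} \<and> T = tail g r then 1 else 0)\<bar> powr p" for T
        using scale[OF w[of r]] by (simp add: lamp_coords_simps w_def)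
      ultimately show ?thesis using w[of r] by auto
    qed
    have "(\<Sum>(r, T)\<in>?A3. ?D (Inr (Inr (r, T)))) = (\<Sum>r<R. \<Sum>T\<in>{tail f r, tail g r}. ?D (Inr (Inr (r, T))))"
      by (subst sum.Sigma) auto
    moreover have "(\<Sum>r<R. w r) \<le> (\<Sum>r<R. \<Sum>T\<in>{tail f r, tail g r}. ?D (Inr (Inr (r, T))))"
      using row by (intro sum_mono) simp
    moreover have "(\<Sum>r<R. \<Sum>T\<in>{tail f r, tail g r}. ?D (Inr (Inr (r, T)))) \<le> (\<Sum>r<R. 2 * w r)"
      using row by (intro sum_mono) simp
    ultimately show "lamp_kernel p R (\<lambda>z. f z - g z) + real R powr p \<le> Lp_dist_pow p (F f) (F g) \<and>
      Lp_dist_pow p (F f) (F g) \<le> lamp_kernel p R (\<lambda>z. f z - g z) + 2 * real R powr p"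
      unfolding split using sum_w by (simp add: sum_distrib_left[symmetric])
  qed
qed

section \<open>Estimates for the embedding\<close>

text \<open>Lamps in the box \<open>\<bar>z\<bar> \<le> l\<close>, \<open>\<bar>h z\<bar> \<le> l\<close> have total mass at most \<open>(2 l + 1) l\<close>, which for
  \<open>l = sqrt S / 4\<close> is at most \<open>S / 2\<close>. Every lamp outside the box contributes at least \<open>l\<^bsup>p-1\<^esup>\<close> per unit
  of mass: through its height if \<open>\<bar>h z\<bar>\<close> is large, through its weight if \<open>\<bar>z\<bar>\<close> is large.\<close>

lemma lamp_kernel_ge:
  fixes h :: "int \<Rightarrow> int" and R :: nat
  defines "S \<equiv> real_of_int (\<Sum>z\<in>{- int R..int R}. \<bar>h z\<bar>)"
  assumes p: "1 \<le> p" "p \<le> 2" and S: "1 \<le> S"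
  shows "S powr ((p + 1) / 2) / 8 \<le> lamp_kernel p R h"
proof -
  let ?A = "{- int R..int R}" and ?k = "\<lambda>z. \<bar>real_of_int (h z)\<bar>"
  define l where "l = sqrt S / 4"
  define B where "B = {z \<in> ?A. \<bar>real_of_int z\<bar> \<le> l \<and> ?k z \<le> l}"
  have sqrt_S: "1 \<le> sqrt S" "sqrt S * sqrt S = S" using S by auto
  have l: "0 < l" using sqrt_S by (simp add: l_def)
  have S_eq: "S = (\<Sum>z\<in>?A. ?k z)" by (simp add: S_def)
  have B: "B \<subseteq> ?A" by (auto simp: B_def)
  have "B \<subseteq> {- \<lfloor>l\<rfloor>..\<lfloor>l\<rfloor>}"
    unfolding B_def by (auto simp: le_floor_iff minus_le_iff)
  then have "card B \<le> card {- \<lfloor>l\<rfloor>..\<lfloor>l\<rfloor>}" by (intro card_mono) auto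
  moreover have "0 \<le> \<lfloor>l\<rfloor>" using l by simp
  ultimately have "int (card B) \<le> 2 * \<lfloor>l\<rfloor> + 1" by (simp add: nat_le_iff[symmetric] le_nat_iff)
  then have card_B: "real (card B) \<le> 2 * l + 1" using of_int_floor_le[of l] by linarith
  have "(\<Sum>z\<in>B. ?k z) \<le> real (card B) * l"
    by (rule sum_bounded_above) (simp add: B_def)
  also have "\<dots> \<le> (2 * l + 1) * l"
    using card_B l by (intro mult_right_mono) auto
  also have "\<dots> = S / 8 + sqrt S / 4"
    using sqrt_S(2) by (simp add: l_def algebra_simps)
  also have "\<dots> \<le> S / 2"
    using mult_left_mono[OF sqrt_S(1), of "sqrt S"] sqrt_S by simp
  finally have "S / 2 \<le> (\<Sum>z\<in>?A - B. ?k z)"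
    using S_eq sum.subset_diff[OF B, of ?k] by simp
  then have "l powr (p - 1) * (S / 2) \<le> (\<Sum>z\<in>?A - B. l powr (p - 1) * ?k z)"
    unfolding sum_distrib_left[symmetric] by (intro mult_left_mono) auto
  also have "\<dots> \<le> (\<Sum>z\<in>?A - B. ?k z powr p + \<bar>real_of_int z\<bar> powr (p - 1) * ?k z)"
  proof (rule sum_mono)
    fix z assume "z \<in> ?A - B"
    then consider "l < ?k z" | "l < \<bar>real_of_int z\<bar>" by (force simp: B_def)
    then show "l powr (p - 1) * ?k z \<le> ?k z powr p + \<bar>real_of_int z\<bar> powr (p - 1) * ?k z"
    proof cases
      case 1
      have "l powr (p - 1) * ?k z \<le> ?k z powr (p - 1) * ?k z"
        using 1 l p by (intro mult_right_mono powr_mono2) auto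
      also have "\<dots> = ?k z powr p" using powr_mult_base[of "?k z" "p - 1"] by (simp add: mult.commute)
      finally show ?thesis by (simp add: add_increasing2)
    next
      case 2
      then have "l powr (p - 1) * ?k z \<le> \<bar>real_of_int z\<bar> powr (p - 1) * ?k z"
        using l p by (intro mult_right_mono powr_mono2) auto
      then show ?thesis by (simp add: add_increasing)
    qed
  qed
  also have "\<dots> \<le> lamp_kernel p R h"
    unfolding lamp_kernel_def by (intro sum_mono2) auto
  finally have "l powr (p - 1) * (S / 2) \<le> lamp_kernel p R h" .
  moreover have "S powr ((p + 1) / 2) / 8 \<le> l powr (p - 1) * (S / 2)"
  proof -
    have "l powr (p - 1) = S powr ((p - 1) / 2) / 4 powr (p - 1)"
      using S unfolding l_def by (simp add: powr_divide powr_half_sqrt[symmetric] powr_powr)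
    moreover have "S powr ((p - 1) / 2) * S = S powr ((p + 1) / 2)"
      using S powr_mult_base[of S "(p - 1) / 2"] by (simp add: field_simps)
    moreover have "4 powr (p - 1) \<le> (4::real)" using p powr_mono[of "p - 1" 1 4] by simp
    then have "S powr ((p + 1) / 2) / 8 \<le> S powr ((p + 1) / 2) / (2 * 4 powr (p - 1))"
      by (intro divide_left_mono) auto
    ultimately show ?thesis by simp
  qed
  ultimately show ?thesis by linarith
qed

text \<open>Per unit of mass a lamp contributes \<open>\<bar>h z\<bar>\<^bsup>p-1\<^esup> + \<bar>z\<bar>\<^bsup>p-1\<^esup> \<le> 2 D\<^bsup>p-1\<^esup>\<close>.\<close>

lemma lamp_kernel_le:
  fixes h :: "int \<Rightarrow> int" and R :: nat
  defines "S \<equiv> real_of_int (\<Sum>z\<in>{- int R..int R}. \<bar>h z\<bar>)"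
  assumes p: "1 \<le> p" and D: "S \<le> D" "real R \<le> D"
  shows "lamp_kernel p R h \<le> 2 * D powr p"
proof -
  let ?A = "{- int R..int R}" and ?k = "\<lambda>z. \<bar>real_of_int (h z)\<bar>"
  have S_eq: "S = (\<Sum>z\<in>?A. ?k z)" by (simp add: S_def)
  have D0: "0 \<le> D" using D by linarith
  have "?k z powr p + \<bar>real_of_int z\<bar> powr (p - 1) * ?k z \<le> 2 * D powr (p - 1) * ?k z" if z: "z \<in> ?A" for z
  proof -
    have "?k z \<le> S" unfolding S_eq using z by (intro member_le_sum) auto
    then have "?k z powr (p - 1) * ?k z \<le> D powr (p - 1) * ?k z"
      using D p by (intro mult_right_mono powr_mono2) auto
    moreover have "?k z powr (p - 1) * ?k z = ?k z powr p"
      using powr_mult_base[of "?k z" "p - 1"] by (simp add: mult.commute)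
    moreover have "\<bar>real_of_int z\<bar> powr (p - 1) * ?k z \<le> D powr (p - 1) * ?k z"
      using z D p by (intro mult_right_mono powr_mono2) auto
    ultimately show ?thesis by simp
  qed
  then have "lamp_kernel p R h \<le> (\<Sum>z\<in>?A. 2 * D powr (p - 1) * ?k z)"
    unfolding lamp_kernel_def by (rule sum_mono)
  also have "\<dots> = 2 * D powr (p - 1) * S" by (simp add: S_eq sum_distrib_left)
  also have "\<dots> \<le> 2 * D powr (p - 1) * D" using D by (intro mult_left_mono) auto
  also have "\<dots> = 2 * D powr p" using powr_mult_base[OF D0, of "p - 1"] by (simp add: mult.commute)
  finally show ?thesis .
qed

text \<open>With \<open>b = (p + 1) / 2\<close> the distance satisfies \<open>d\<^sup>b \<le> 64 (R\<^sup>b + S\<^sup>b)\<close>. Here \<open>R\<^sup>b \<le> R\<^sup>p\<close> is covered by the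
  tail coordinates and \<open>S\<^sup>b\<close> by \<open>lamp_kernel_ge\<close>.\<close>

lemma compression_exponent_attained:
  assumes p: "1 \<le> p" "p \<le> 2"
  shows "\<exists>F. (\<forall>x\<in>ZwrZ_zero_section. F x \<in> Lp p) \<and>
    (\<exists>L\<ge>0. \<forall>x\<in>ZwrZ_zero_section. \<forall>y\<in>ZwrZ_zero_section.
       Lp_norm p (\<lambda>t. F x t - F y t) \<le> L * d_ZwrZ x y) \<and>
    (\<exists>c>0. \<forall>x\<in>ZwrZ_zero_section. \<forall>y\<in>ZwrZ_zero_section.
       Lp_norm p (\<lambda>t. F x t - F y t) \<ge> c * d_ZwrZ x y powr ((p + 1) / (2 * p)))"
proof -
  let ?a = "(p + 1) / (2 * p)"
  define b where "b = (p + 1) / 2"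
  have b: "0 \<le> b" "b \<le> 2" "b \<le> p" "b * (1 / p) = ?a"
    using p by (auto simp: b_def)
  obtain F :: "(int \<Rightarrow> int) \<Rightarrow> real \<Rightarrow> real" where F: "\<And>f. finite {z. f z \<noteq> 0} \<Longrightarrow> F f \<in> Lp p"
    "\<And>f g R. finite {z. f z \<noteq> 0} \<Longrightarrow> finite {z. g z \<noteq> 0} \<Longrightarrow>
      (\<And>z. f z \<noteq> g z \<Longrightarrow> \<bar>z\<bar> \<le> int R) \<Longrightarrow> (\<exists>z. f z \<noteq> g z \<and> \<bar>z\<bar> = int R) \<Longrightarrow>
      lamp_kernel p R (\<lambda>z. f z - g z) + real R powr p \<le> Lp_dist_pow p (F f) (F g) \<and>
      Lp_dist_pow p (F f) (F g) \<le> lamp_kernel p R (\<lambda>z. f z - g z) + 2 * real R powr p"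
    using lamp_embedding[OF p(1)] by blast
  have bounds: "Lp_norm p (\<lambda>t. F f t - F g t) \<le> 4 powr (1 / p) * d_ZwrZ (f, 0) (g, 0)"
    "(1 / 512) powr (1 / p) * d_ZwrZ (f, 0) (g, 0) powr ?a \<le> Lp_norm p (\<lambda>t. F f t - F g t)"
    if fin: "finite {z. f z \<noteq> 0}" "finite {z. g z \<noteq> 0}" for f g
  proof -
    have "Lp_norm p (\<lambda>t. F f t - F g t) \<le> 4 powr (1 / p) * d_ZwrZ (f, 0) (g, 0) \<and>
      (1 / 512) powr (1 / p) * d_ZwrZ (f, 0) (g, 0) powr ?a \<le> Lp_norm p (\<lambda>t. F f t - F g t)"
    proof (cases "f = g")
      case True
      then show ?thesis
        using d_ZwrZ_self[of g] fin(2) by (auto simp: Lp_norm_def zero_section_iff)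
    next
      case False
      let ?d = "d_ZwrZ (f, 0) (g, 0)" and ?h = "\<lambda>z. f z - g z"
      have "{z. f z \<noteq> g z} \<subseteq> {z. f z \<noteq> 0} \<union> {z. g z \<noteq> 0}" by auto
      then have "finite {z. f z \<noteq> g z}" using fin by (meson finite_UnI finite_subset)
      then obtain R :: nat where R: "\<And>z. f z \<noteq> g z \<Longrightarrow> \<bar>z\<bar> \<le> int R" "\<exists>z. f z \<noteq> g z \<and> \<bar>z\<bar> = int R"
        using exists_int_support_bound[of "\<lambda>z. f z \<noteq> g z"] False by (metis ext)
      define S where "S = real_of_int (\<Sum>z\<in>{- int R..int R}. \<bar>f z - g z\<bar>)"
      note d = d_ZwrZ_bounds[OF fin R, folded S_def]
      note K = F(2)[OF fin R]
      have d0: "0 \<le> ?d" using d(3) by linarith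
      have "Lp_dist_pow p (F f) (F g) \<le> 2 * ?d powr p + 2 * real R powr p"
        using K lamp_kernel_le[OF p(1), of ?h R ?d] d unfolding S_def by auto
      moreover have "real R powr p \<le> ?d powr p" using d(3) p by (intro powr_mono2) auto
      ultimately have upper: "Lp_dist_pow p (F f) (F g) \<le> 4 * ?d powr p" by simp
      have "?d powr b \<le> (8 * max (real R) S) powr b"
        using d d0 b by (intro powr_mono2) auto
      also have "\<dots> = 8 powr b * max (real R) S powr b" by (simp add: powr_mult)
      also have "\<dots> \<le> 64 * (real R powr b + S powr b)"
      proof (intro mult_mono)
        show "8 powr b \<le> (64 :: real)" using b powr_mono[of b 2 8] by simp
        show "max (real R) S powr b \<le> real R powr b + S powr b"
          by (cases "real R \<le> S") (auto simp: max_def)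
      qed auto
      \<comment> \<open>The natural number \<open>R\<close> may vanish, otherwise it is at least \<open>1\<close>.\<close>
      also have "real R powr b \<le> real R powr p"
        using b by (cases "R = 0") (auto intro!: powr_mono)
      also have "64 * (real R powr p + S powr b) \<le> 512 * (S powr b / 8 + real R powr p)"
        by simp
      also have "S powr b / 8 + real R powr p \<le> Lp_dist_pow p (F f) (F g)"
        using K lamp_kernel_ge[OF p, of ?h R, folded b_def] d(1) unfolding S_def by simp
      finally have lower: "?d powr b / 512 \<le> Lp_dist_pow p (F f) (F g)" by simp
      have norm: "Lp_norm p (\<lambda>t. F f t - F g t) = Lp_dist_pow p (F f) (F g) powr (1 / p)"
        using p by (intro Lp_norm_diff_powr) auto
      have "Lp_norm p (\<lambda>t. F f t - F g t) \<le> (4 * ?d powr p) powr (1 / p)"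
        unfolding norm using p upper by (intro powr_mono2 Lp_norm_diff_powr(3)) auto
      also have "\<dots> = 4 powr (1 / p) * ?d" using p d0 by (simp add: powr_mult powr_powr)
      finally have 1: "Lp_norm p (\<lambda>t. F f t - F g t) \<le> 4 powr (1 / p) * ?d" .
      have "(1 / 512) powr (1 / p) * ?d powr ?a = (1 / 512 * ?d powr b) powr (1 / p)"
        by (simp only: b(4)[symmetric] powr_mult powr_powr)
      also have "\<dots> \<le> Lp_norm p (\<lambda>t. F f t - F g t)"
        unfolding norm using p lower by (intro powr_mono2) auto
      finally show ?thesis using 1 by simp
    qed
    then show "Lp_norm p (\<lambda>t. F f t - F g t) \<le> 4 powr (1 / p) * d_ZwrZ (f, 0) (g, 0)"
      "(1 / 512) powr (1 / p) * d_ZwrZ (f, 0) (g, 0) powr ?a \<le> Lp_norm p (\<lambda>t. F f t - F g t)"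
      by blast+
  qed
  show ?thesis
  proof (intro exI[of _ "\<lambda>x. F (fst x)"] conjI)
    show "\<forall>x\<in>ZwrZ_zero_section. F (fst x) \<in> Lp p"
      by (auto simp: zero_section_iff F(1))
    show "\<exists>L\<ge>0. \<forall>x\<in>ZwrZ_zero_section. \<forall>y\<in>ZwrZ_zero_section.
        Lp_norm p (\<lambda>t. F (fst x) t - F (fst y) t) \<le> L * d_ZwrZ x y"
      by (intro exI[of _ "4 powr (1 / p)"]) (auto simp: zero_section_iff bounds(1))
    show "\<exists>c>0. \<forall>x\<in>ZwrZ_zero_section. \<forall>y\<in>ZwrZ_zero_section.
        c * d_ZwrZ x y powr ?a \<le> Lp_norm p (\<lambda>t. F (fst x) t - F (fst y) t)"
      by (intro exI[of _ "(1 / 512) powr (1 / p)"]) (auto simp: zero_section_iff intro!: bounds(2))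
  qed
qed

section \<open>The compression exponent\<close>

theorem theorem4p1:
  fixes p :: real
  assumes "p \<in> {1..2}"
  shows "alpha_star p ZwrZ_zero_section d_ZwrZ = ennreal ((p + 1) / (2 * p))"
proof -
  have p: "1 \<le> p" "p \<le> 2" using assms by auto
  show ?thesis
    unfolding alpha_star_def
  proof (rule antisym, rule Sup_least, elim CollectE exE conjE)
    fix e \<alpha> F L c
    assume "e = ennreal \<alpha>" "0 \<le> \<alpha>" "\<forall>x\<in>ZwrZ_zero_section. F x \<in> Lp p"
      "0 \<le> L" "\<forall>x\<in>ZwrZ_zero_section. \<forall>y\<in>ZwrZ_zero_section. Lp_norm p (\<lambda>t. F x t - F y t) \<le> L * d_ZwrZ x y"
      "0 < c" "\<forall>x\<in>ZwrZ_zero_section. \<forall>y\<in>ZwrZ_zero_section. Lp_norm p (\<lambda>t. F x t - F y t) \<ge> c * d_ZwrZ x y powr \<alpha>"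
    then show "e \<le> ennreal ((p + 1) / (2 * p))"
      using compression_exponent_le[OF p, of \<alpha> F L c] by (simp add: ennreal_leI)
  qed (use p compression_exponent_attained[OF p] in
      \<open>intro Sup_upper CollectI exI[of _ "(p + 1) / (2 * p)"] conjI refl, auto\<close>)
qed

end
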